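(* Fix $d\in\mathbb{N}$ and $n\ge d+1$. Let $X_1,\dots,X_n$ be independent standard Gaussian random vectors in $\mathbb{R}^d$ and let $\mathcal{P}_{n,d}=\mathrm{conv}(X_1,\dots,X_n)$. Then for every $j\in\{0,\dots,d-1\}$, $$\mathbb{E}\sum_{F\in\mathcal{F}_j(\mathcal{P}_{n,d})}\alpha\big(N_F(\mathcal{P}_{n,d})\big)=\sigma\genfrac{[}{]}{0pt}{}{n}{j+1}.$$
   Context: $\mathbb{N}=\{1,2,\dots\}$. The solid angle of a polyhedral cone $C$ (the set of nonnegative linear combinations of finitely many vectors) is $\alpha(C)=\mathbb{P}[Z\in C]$ with $Z$ uniformly distributed on the unit sphere of the linear hull of $C$; $\alpha(C)=1$ if $C$ is a linear subspace (including $C=\{0\}$). For a polytope $P$, $\mathcal{F}_j(P)$ is the set of its $j$-dimensional faces ($P$ itself being a face). The tangent cone of $P\subset\mathbb{R}^d$ at a face $F$ is $T_F(P)=\{v\in\mathbb{R}^d: f_0+\varepsilon v\in P\text{ for some }\varepsilon>0\}$, where $f_0$ is any point of the relative interior of $F$. The normal cone is the polar cone $N_F(P)=\{w:\langle w,u\rangle\le 0\ \text{for all } u\in T_F(P)\}$. For a random polytope, angles are computed for each realization. External angle sums of the regular simplex: let $e_1,\dots,e_n$ be the standard basis of $\mathbb{R}^n$ and $\Delta_n=\mathrm{conv}(e_1,\dots,e_n)$, $\Delta_k=\mathrm{conv}(e_1,\dots,e_k)\subset\mathbb{R}^n$ for $k\le n$. For $n\in\mathbb{N}$ and $k\in\{1,\dots,n\}$,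 $$\sigma\genfrac{[}{]}{0pt}{}{n}{k}=\binom nk\,\alpha(N_{\Delta_k}(\Delta_n)).$$ *)

theory Defs
  imports "HOL-Probability.Probability"
begin

text \<open>
  The uniform distribution on the unit sphere of a linear subspace \<open>L\<close>: the rotation-invariant
  probability measure concentrated on that sphere. Every linear isometry of \<open>L\<close> extends to an
  orthogonal transformation of the whole space, so quantifying over the latter loses nothing.
\<close>

definition uniform_on_sphere :: "'a::euclidean_space set \<Rightarrow> 'a measure \<Rightarrow> bool" where
  "uniform_on_sphere L \<mu> \<longleftrightarrow>
     prob_space \<mu> \<and> sets \<mu> = sets borel \<and> measure \<mu> (sphere 0 1 \<inter> L) = 1 \<and>
     (\<forall>f. orthogonal_transformation f \<and> f ` L = L \<longrightarrow> distr \<mu> borel f = \<mu>)"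

definition sphere_measure :: "'a::euclidean_space set \<Rightarrow> 'a measure" where
  "sphere_measure L = (THE \<mu>. uniform_on_sphere L \<mu>)"

text \<open>
  The first case only matters for \<open>C = {0}\<close>, where the unit sphere of the linear hull is empty.
\<close>

definition solid_angle :: "'a::euclidean_space set \<Rightarrow> real" where
  "solid_angle C = (if subspace C then 1 else measure (sphere_measure (span C)) C)"

text \<open>
  For a face of a convex set, the tangent cone does not depend on the choice of the point
  \<open>f\<^sub>0\<close>; see \<open>tangent_cone_eq\<close> below.
\<close>

definition tangent_cone :: "'a::euclidean_space set \<Rightarrow> 'a set \<Rightarrow> 'a set" where
  "tangent_cone F P = {v. \<exists>f\<^sub>0\<in>rel_interior F. \<exists>\<epsilon>>0. f\<^sub>0 + \<epsilon> *\<^sub>R v \<in> P}"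

definition normal_cone :: "'a::euclidean_space set \<Rightarrow> 'a set \<Rightarrow> 'a set" where
  "normal_cone F P = {w. \<forall>u\<in>tangent_cone F P. w \<bullet> u \<le> 0}"

definition faces :: "nat \<Rightarrow> 'a::euclidean_space set \<Rightarrow> 'a set set" where
  "faces j P = {F. F face_of P \<and> aff_dim F = int j}"

text \<open>
  External angle sums of the regular simplex. Here \<open>e 1, \<dots>, e n\<close> enumerates the standard basis of
  an \<open>n\<close>-dimensional space: coordinates are indexed by a finite type, which carries no canonical
  order, so the enumeration is a parameter.
\<close>

definition std_simplex :: "(nat \<Rightarrow> 'a::euclidean_space) \<Rightarrow> nat \<Rightarrow> 'a set" where
  "std_simplex e k = convex hull (e ` {1..k})"

definition ext_angle_sum :: "(nat \<Rightarrow> 'a::euclidean_space) \<Rightarrow> nat \<Rightarrow> nat \<Rightarrow> real" where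
  "ext_angle_sum e n k =
     real (n choose k) * solid_angle (normal_cone (std_simplex e k) (std_simplex e n))"

definition std_gaussian_vector :: "'w measure \<Rightarrow> ('w \<Rightarrow> real ^ 'd) \<Rightarrow> bool" where
  "std_gaussian_vector M Y \<longleftrightarrow>
     distributed M lborel Y (\<lambda>x. ennreal (\<Prod>i\<in>UNIV. std_normal_density (x $ i)))"

lemma tangent_cone_eq:
  assumes "convex P" "F face_of P" "f\<^sub>0 \<in> rel_interior F"
  shows "tangent_cone F P = {v. \<exists>\<epsilon>>0. f\<^sub>0 + \<epsilon> *\<^sub>R v \<in> P}"
proof -
  have "\<exists>\<epsilon>>0. f\<^sub>0 + \<epsilon> *\<^sub>R v \<in> P"
    if f1: "f1 \<in> rel_interior F" and e: "\<epsilon> > 0" "f1 + \<epsilon> *\<^sub>R v \<in> P" for f1 \<epsilon> v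
  proof -
    have "convex F" using assms face_of_imp_convex by blast
    moreover have "f1 \<in> F" using f1 rel_interior_subset by blast
    ultimately obtain m where m: "m > 1" "(1 - m) *\<^sub>R f1 + m *\<^sub>R f\<^sub>0 \<in> F"
      using convex_rel_interior_iff[of F f\<^sub>0] assms(3) by blast
    define g where "g = (1 - m) *\<^sub>R f1 + m *\<^sub>R f\<^sub>0"
    have "g \<in> P" using m assms(2) face_of_imp_subset unfolding g_def by blast
    then have "(1 / m) *\<^sub>R g + (1 - 1 / m) *\<^sub>R (f1 + \<epsilon> *\<^sub>R v) \<in> P"
      using m(1) e(2) \<open>convex P\<close> unfolding convex_def by simp
    also have "(1 / m) *\<^sub>R g + (1 - 1 / m) *\<^sub>R (f1 + \<epsilon> *\<^sub>R v) = f\<^sub>0 + ((1 - 1 / m) * \<epsilon>) *\<^sub>R v"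
      using m(1) by (simp add: g_def algebra_simps diff_divide_distrib)
    finally show ?thesis using m(1) e(1) by (intro exI[of _ "(1 - 1 / m) * \<epsilon>"]) simp
  qed
  then show ?thesis using assms(3) unfolding tangent_cone_def by blast
qed

text \<open>
  \<open>sphere_measure L\<close> is well defined: the rotation-invariant probability measure on the unit sphere
  of \<open>L \<noteq> {0}\<close> exists and is unique.
\<close>

lemma orthogonal_transformation_norm_eq:
  fixes s t :: "'a::euclidean_space"
  assumes "subspace L" "s \<in> L" "t \<in> L" "norm s = norm t"
  obtains f where "orthogonal_transformation f" "f ` L = L" "f s = t"
proof (cases "s = t")
  case True
  then show ?thesis using that[of "\<lambda>x. x"] by simp
next
  case False
  define a where "a = s - t"
  have a: "a \<noteq> 0" "a \<in> L" using False assms by (auto simp: a_def subspace_diff)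
  define f where "f = (\<lambda>x. x - (2 * (x \<bullet> a) / (a \<bullet> a)) *\<^sub>R a)"
  have lin: "linear f"
    by (rule linearI) (simp_all add: f_def inner_left_distrib algebra_simps add_divide_distrib)
  have inn: "f x \<bullet> f y = x \<bullet> y" for x y
    using a(1) by (simp add: f_def inner_diff_left inner_diff_right inner_commute field_simps)
  have orth: "orthogonal_transformation f"
    using lin inn by (simp add: orthogonal_transformation_def)
  have ff: "f (f x) = x" for x
    using a(1) by (simp add: f_def inner_diff_left algebra_simps)
  have fL: "f x \<in> L" if "x \<in> L" for x
    using that a(2) assms(1) by (simp add: f_def subspace_diff subspace_scale)
  have img: "f ` L = L"
    using fL ff by (auto simp: image_iff intro!: bexI[of _ "f _"])
  have "2 * (s \<bullet> a) = a \<bullet> a"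
    using assms(4) by (simp add: a_def norm_eq inner_diff_left inner_diff_right inner_commute)
  then have "f s = t" using a(1) by (simp add: f_def a_def)
  with orth img show ?thesis using that by blast
qed

lemma finite_measure_eqI_continuous:
  fixes \<mu> \<nu> :: "'a::euclidean_space measure"
  assumes "prob_space \<mu>" "prob_space \<nu>" and [measurable_cong, simp]: "sets \<mu> = sets borel" "sets \<nu> = sets borel"
  assumes eq: "\<And>f::'a \<Rightarrow> real. continuous_on UNIV f \<Longrightarrow> bounded (range f) \<Longrightarrow> integral\<^sup>L \<mu> f = integral\<^sup>L \<nu> f"
  shows "\<mu> = \<nu>"
proof -
  interpret m: prob_space \<mu> by fact
  interpret n: prob_space \<nu> by fact
  have cl: "measure \<mu> C = measure \<nu> C" if C: "closed C" "C \<noteq> {}" for C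
  proof -
    define g :: "nat \<Rightarrow> 'a \<Rightarrow> real" where "g = (\<lambda>n x. max 0 (1 - real n * infdist x C))"
    have cont: "continuous_on UNIV (g n)" for n
      unfolding g_def by (intro continuous_intros)
    then have [measurable]: "g n \<in> borel_measurable borel" for n
      by (simp add: borel_measurable_continuous_onI)
    have bd: "\<bar>g n x\<bar> \<le> 1" for n x by (simp add: g_def infdist_nonneg)
    have Cm[measurable]: "C \<in> sets borel" using C by simp
    have lim: "(\<lambda>n. g n x) \<longlonglongrightarrow> indicator C x" for x
    proof (cases "x \<in> C")
      case True then show ?thesis by (simp add: g_def)
    next
      case False
      then have pos: "infdist x C > 0" using C in_closed_iff_infdist_zero[of C x] infdist_nonneg[of x C] by force
      obtain N where N: "1 < real N * infdist x C" using reals_Archimedean3[OF pos] by blast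
      have "g n x = 0" if "n \<ge> N" for n
      proof -
        have "real N * infdist x C \<le> real n * infdist x C" using that pos by (simp)
        with N show ?thesis by (simp add: g_def)
      qed
      then have "eventually (\<lambda>n. g n x = 0) sequentially" by (auto simp: eventually_sequentially)
      with False show ?thesis by (simp add: tendsto_eventually)
    qed
    have "(\<lambda>n. integral\<^sup>L \<mu> (g n)) \<longlonglongrightarrow> integral\<^sup>L \<mu> (indicator C)"
      by (rule integral_dominated_convergence[where w="\<lambda>_. 1"]) (use lim bd in auto)
    moreover have "(\<lambda>n. integral\<^sup>L \<nu> (g n)) \<longlonglongrightarrow> integral\<^sup>L \<nu> (indicator C)"
      by (rule integral_dominated_convergence[where w="\<lambda>_. 1"]) (use lim bd in auto)
    moreover have "integral\<^sup>L \<mu> (g n) = integral\<^sup>L \<nu> (g n)" for n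
      using eq[OF cont] bd by (auto simp: bounded_iff)
    ultimately have "integral\<^sup>L \<mu> (indicator C) = integral\<^sup>L \<nu> (indicator C :: 'a \<Rightarrow> real)"
      using LIMSEQ_unique by auto
    then show ?thesis using sets_eq_imp_space_eq[OF \<open>sets \<mu> = sets borel\<close>] sets_eq_imp_space_eq[OF \<open>sets \<nu> = sets borel\<close>] by simp
  qed
  show ?thesis
  proof (rule measure_eqI_generator_eq[where \<Omega>=UNIV and E="Collect closed" and A="\<lambda>_. UNIV"])
    show "Int_stable (Collect closed :: 'a set set)" by (auto simp: Int_stable_def)
    show "emeasure \<mu> C = emeasure \<nu> C" if "C \<in> Collect closed" for C
      using that cl[of C] by (cases "C = {}") (simp_all add: m.emeasure_eq_measure n.emeasure_eq_measure)
    show "sets \<mu> = sigma_sets UNIV (Collect closed)" "sets \<nu> = sigma_sets UNIV (Collect closed)"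
      by (simp_all add: borel_eq_closed)
  qed auto
qed

inductive_set exp_alg :: "'a::euclidean_space set \<Rightarrow> ('a \<Rightarrow> real) set" for L where
  base: "t \<in> L \<Longrightarrow> (\<lambda>x. c * exp (x \<bullet> t)) \<in> exp_alg L"
| add: "f \<in> exp_alg L \<Longrightarrow> g \<in> exp_alg L \<Longrightarrow> (\<lambda>x. f x + g x) \<in> exp_alg L"

lemma uniform_on_sphere_unique:
  fixes L :: "'a::euclidean_space set"
  assumes L: "subspace L" and mu: "uniform_on_sphere L \<mu>" and nu: "uniform_on_sphere L \<nu>"
  shows "\<mu> = \<nu>"
proof -
  let ?S = "sphere 0 1 \<inter> L"
  interpret m: prob_space \<mu> using mu by (simp add: uniform_on_sphere_def)
  interpret n: prob_space \<nu> using nu by (simp add: uniform_on_sphere_def)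
  interpret p: pair_prob_space \<mu> \<nu> ..
  have sm[measurable_cong, simp]: "sets \<mu> = sets borel" and sn[measurable_cong, simp]: "sets \<nu> = sets borel"
    using mu nu by (auto simp: uniform_on_sphere_def)
  have cS: "compact ?S" using L by (simp add: closed_subspace compact_Int_closed)
  then have Sm[measurable]: "?S \<in> sets borel" by (simp add: borel_compact)
  have Lm[measurable]: "L \<in> sets borel" using L by (simp add: closed_subspace)
  have AEm: "AE x in \<mu>. x \<in> ?S" using mu m.prob_eq_1[of ?S] by (simp add: uniform_on_sphere_def)
  have AEn: "AE x in \<nu>. x \<in> ?S" using nu n.prob_eq_1[of ?S] by (simp add: uniform_on_sphere_def)
  define h where "h = (\<lambda>(\<rho>::'a measure) t. \<integral>x. exp (x \<bullet> t) \<partial>\<rho>)"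
  have rad: "h \<rho> s = h \<rho> t" if asm: "uniform_on_sphere L \<rho>" "s \<in> L" "t \<in> L" "norm s = norm t" for \<rho> s t
  proof -
    obtain f where f: "orthogonal_transformation f" "f ` L = L" "f s = t"
      using orthogonal_transformation_norm_eq[OF L asm(2-4)] .
    have [measurable_cong]: "sets \<rho> = sets borel" and d: "distr \<rho> borel f = \<rho>"
      using asm(1) f by (auto simp: uniform_on_sphere_def)
    have "linear f" using f(1) orthogonal_transformation_def by blast
    then have [measurable]: "f \<in> borel_measurable borel"
      by (simp add: borel_measurable_continuous_onI linear_continuous_on linear_linear)
    have "h \<rho> t = (\<integral>x. exp (x \<bullet> f s) \<partial>distr \<rho> borel f)" unfolding h_def d f(3) ..
    also have "\<dots> = (\<integral>x. exp (f x \<bullet> f s) \<partial>\<rho>)" by (subst integral_distr) auto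
    also have "\<dots> = h \<rho> s" using f(1) by (simp add: h_def orthogonal_transformation_def)
    finally show ?thesis by simp
  qed
  have bound: "\<bar>exp (x \<bullet> t)\<bar> \<le> exp (norm t)" if "x \<in> ?S" for x t
  proof -
    have "x \<bullet> t \<le> norm x * norm t" by (rule norm_cauchy_schwarz)
    then show ?thesis using that by simp
  qed
  have heq: "h \<mu> t = h \<nu> t" if t: "t \<in> L" for t
  proof -
    define r where "r = norm t"
    have AEp: "AE z in \<mu> \<Otimes>\<^sub>M \<nu>. fst z \<in> ?S \<and> snd z \<in> ?S"
    proof -
      have "AE z in \<mu> \<Otimes>\<^sub>M \<nu>. fst z \<in> ?S"
        using AEm by (intro p.AE_pair_measure) (measurable, auto simp: space_pair_measure)
      moreover have "AE z in \<mu> \<Otimes>\<^sub>M \<nu>. snd z \<in> ?S"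
        using AEn by (intro p.AE_pair_measure) (measurable, auto simp: space_pair_measure)
      ultimately show ?thesis by eventually_elim simp
    qed
    have int: "integrable (\<mu> \<Otimes>\<^sub>M \<nu>) (\<lambda>(x,y). exp (x \<bullet> (r *\<^sub>R y)))"
    proof (rule p.P.integrable_const_bound[where B="exp r"])
      show "AE z in \<mu> \<Otimes>\<^sub>M \<nu>. norm (case z of (x, y) \<Rightarrow> exp (x \<bullet> (r *\<^sub>R y))) \<le> exp r"
        using AEp
      proof eventually_elim
        case (elim z)
        then show ?case using bound[of "fst z" "r *\<^sub>R snd z"] by (simp add: case_prod_beta r_def)
      qed
    qed simp
    have "h \<mu> t = (\<integral>y. h \<mu> t \<partial>\<nu>)" by (simp add: n.prob_space)
    also have "\<dots> = (\<integral>y. h \<mu> (r *\<^sub>R y) \<partial>\<nu>)"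
    proof (rule integral_cong_AE)
      show "AE y in \<nu>. h \<mu> t = h \<mu> (r *\<^sub>R y)" using AEn
      proof eventually_elim
        case (elim y)
        then show ?case by (intro rad[OF mu t]) (auto simp: r_def L subspace_scale)
      qed
    qed (simp_all add: h_def)
    also have "\<dots> = (\<integral>y. (\<integral>x. exp (x \<bullet> (r *\<^sub>R y)) \<partial>\<mu>) \<partial>\<nu>)" by (simp add: h_def)
    also have "\<dots> = (\<integral>x. (\<integral>y. exp (x \<bullet> (r *\<^sub>R y)) \<partial>\<nu>) \<partial>\<mu>)"
      by (rule p.Fubini_integral[OF int])
    also have "\<dots> = (\<integral>x. h \<nu> (r *\<^sub>R x) \<partial>\<mu>)" by (simp add: h_def inner_commute)
    also have "\<dots> = (\<integral>x. h \<nu> t \<partial>\<mu>)"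
    proof (rule integral_cong_AE)
      show "AE y in \<mu>. h \<nu> (r *\<^sub>R y) = h \<nu> t" using AEm
      proof eventually_elim
        case (elim y)
        then show ?case by (intro rad[OF nu _ t]) (auto simp: r_def L subspace_scale)
      qed
    qed (simp_all add: h_def)
    also have "\<dots> = h \<nu> t" by (simp add: m.prob_space)
    finally show ?thesis .
  qed
  have mult: "(\<lambda>x. f x * g x) \<in> exp_alg L" if fA: "f \<in> exp_alg L" and gA: "g \<in> exp_alg L" for f g
    using fA
  proof induction
    case (base s c)
    show ?case using gA
    proof induction
      case (base t d)
      have "(\<lambda>x. (c * d) * exp (x \<bullet> (s + t))) \<in> exp_alg L"
        using \<open>s \<in> L\<close> base L by (intro exp_alg.base) (simp add: subspace_add)
      then show ?case by (simp add: inner_right_distrib exp_add mult_ac)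
    next
      case (add f g)
      show ?case using exp_alg.add[OF add.IH] by (simp add: algebra_simps)
    qed
  next
    case (add f1 f2)
    show ?case using exp_alg.add[OF add.IH] by (simp add: algebra_simps)
  qed
  have contA: "continuous_on UNIV g" if "g \<in> exp_alg L" for g
    using that by induction (auto intro!: continuous_intros)
  have alg: "function_ring_on (exp_alg L) ?S"
  proof
    fix x y assume xy: "x \<in> ?S" "y \<in> ?S" "x \<noteq> y"
    have "(x - y) \<bullet> (x - y) \<noteq> 0" using xy by simp
    then have "x \<bullet> (x - y) \<noteq> y \<bullet> (x - y)" by (simp add: inner_diff_left)
    moreover have "(\<lambda>z. 1 * exp (z \<bullet> (x - y))) \<in> exp_alg L"
      using xy L by (intro exp_alg.base) (auto simp: subspace_diff)
    ultimately show "\<exists>f\<in>exp_alg L. f x \<noteq> f y" by (intro bexI) auto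
  next
    fix c :: real
    show "(\<lambda>_. c) \<in> exp_alg L" using exp_alg.base[of 0 L c] L by (simp add: subspace_0)
  qed (use cS mult exp_alg.add continuous_on_subset[OF contA subset_UNIV] in blast)+
  have intg: "integrable \<rho> f" if "prob_space \<rho>" "sets \<rho> = sets borel" "AE x in \<rho>. x \<in> ?S" and f: "continuous_on UNIV f" for f :: "'a \<Rightarrow> real" and \<rho>
  proof -
    interpret prob_space \<rho> by fact
    have "compact (f ` ?S)" using cS f compact_continuous_image continuous_on_subset by blast
    then obtain B where B: "\<And>x. x \<in> ?S \<Longrightarrow> norm (f x) \<le> B"
      using compact_imp_bounded bounded_iff by (metis imageI)
    show ?thesis
    proof (rule integrable_const_bound)
      show "AE x in \<rho>. norm (f x) \<le> B" using that(3) by eventually_elim (use B in auto)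
      show "f \<in> borel_measurable \<rho>"
        using that(2,4) borel_measurable_continuous_onI measurable_cong_sets by blast
    qed
  qed
  have intm: "integrable \<mu> f" and intn: "integrable \<nu> f" if "continuous_on UNIV f" for f :: "'a \<Rightarrow> real"
    using intg[OF m.prob_space_axioms sm AEm that] intg[OF n.prob_space_axioms sn AEn that] .
  have eqA: "integral\<^sup>L \<mu> g = integral\<^sup>L \<nu> g" if "g \<in> exp_alg L" for g
    using that
  proof induction
    case (base t c)
    then show ?case using heq[OF base] by (simp add: h_def)
  next
    case (add f g)
    then show ?case using contA intm intn by (simp add: Bochner_Integration.integral_add)
  qed
  show ?thesis
  proof (rule finite_measure_eqI_continuous[OF m.prob_space_axioms n.prob_space_axioms sm sn])
    fix f :: "'a \<Rightarrow> real" assume f: "continuous_on UNIV f"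
    have "\<bar>integral\<^sup>L \<mu> f - integral\<^sup>L \<nu> f\<bar> \<le> \<epsilon>" if e: "\<epsilon> > 0" for \<epsilon>
    proof -
      obtain g where g: "g \<in> exp_alg L" "\<And>x. x \<in> ?S \<Longrightarrow> \<bar>f x - g x\<bar> < \<epsilon> / 2"
        using function_ring_on.Stone_Weierstrass_basic[OF alg, of f "\<epsilon> / 2"] f e continuous_on_subset
        by (metis half_gt_zero subset_UNIV)
      have cg: "continuous_on UNIV g" using contA g by blast
      have *: "\<bar>integral\<^sup>L \<rho> f - integral\<^sup>L \<rho> g\<bar> \<le> \<epsilon> / 2"
        if "prob_space \<rho>" "integrable \<rho> f" "integrable \<rho> g" "AE x in \<rho>. x \<in> ?S" for \<rho>
      proof -
        interpret prob_space \<rho> by fact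
        have "\<bar>integral\<^sup>L \<rho> f - integral\<^sup>L \<rho> g\<bar> = \<bar>\<integral>x. f x - g x \<partial>\<rho>\<bar>" using that by simp
        also have "\<dots> \<le> (\<integral>x. \<bar>f x - g x\<bar> \<partial>\<rho>)" by (rule integral_abs_bound)
        also have "\<dots> \<le> (\<integral>x. \<epsilon> / 2 \<partial>\<rho>)"
        proof (rule integral_mono_AE)
          show "AE x in \<rho>. \<bar>f x - g x\<bar> \<le> \<epsilon> / 2"
            using that(4) by eventually_elim (use g(2) in \<open>auto intro: less_imp_le\<close>)
        qed (use that in auto)
        finally show ?thesis by (simp add: prob_space)
      qed
      have "\<bar>integral\<^sup>L \<mu> f - integral\<^sup>L \<mu> g\<bar> \<le> \<epsilon> / 2" "\<bar>integral\<^sup>L \<nu> f - integral\<^sup>L \<nu> g\<bar> \<le> \<epsilon> / 2"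
        using *[OF m.prob_space_axioms intm[OF f] intm[OF cg] AEm]
          *[OF n.prob_space_axioms intn[OF f] intn[OF cg] AEn] .
      then show ?thesis using eqA[OF g(1)] by linarith
    qed
    then show "integral\<^sup>L \<mu> f = integral\<^sup>L \<nu> f" 
      using field_le_epsilon[of "\<bar>integral\<^sup>L \<mu> f - integral\<^sup>L \<nu> f\<bar>" 0] by simp
  qed
qed

lemma lborel_distr_orthogonal:
  fixes f :: "'a::euclidean_space \<Rightarrow> 'a"
  assumes f: "orthogonal_transformation f"
  shows "distr lborel borel f = lborel"
proof -
  have lin: "linear f" using f orthogonal_transformation_def by blast
  then have fm[measurable]: "f \<in> borel_measurable borel"
    by (simp add: borel_measurable_continuous_onI linear_continuous_on linear_linear)
  define \<nu> where "\<nu> = distr lborel borel f"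
  have [measurable_cong, simp]: "sets \<nu> = sets borel" by (simp add: \<nu>_def)
  have surj: "surj f" using orthogonal_transformation_surj[OF f] .
  have pre: "f -` ball 0 r = ball 0 r" for r
    using orthogonal_transformation_norm[OF f] by (auto simp: dist_norm)
  have nuball: "emeasure \<nu> (ball 0 r) = emeasure lborel (ball 0 r :: 'a set)" for r
    by (simp add: \<nu>_def emeasure_distr pre)
  have finb: "emeasure lborel (ball 0 r :: 'a set) < \<infinity>" for r by (rule emeasure_bounded_finite) simp
  have sf: "sigma_finite_measure \<nu>"
  proof
    show "\<exists>A. countable A \<and> A \<subseteq> sets \<nu> \<and> \<Union> A = space \<nu> \<and> (\<forall>a\<in>A. emeasure \<nu> a \<noteq> \<infinity>)"
    proof (intro exI[of _ "range (\<lambda>n::nat. ball 0 (real n))"] conjI)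
      show "\<Union> (range (\<lambda>n::nat. ball (0::'a) (real n))) = space \<nu>"
        using sets_eq_imp_space_eq[of \<nu> borel] reals_Archimedean2 by auto
    qed (use finb nuball in \<open>auto simp: less_top[symmetric]\<close>)
  qed
  interpret n: sigma_finite_measure \<nu> by fact
  interpret p: pair_sigma_finite \<nu> lborel ..
  have tr: "(\<integral>\<^sup>+x. g (x + y) \<partial>\<nu>) = (\<integral>\<^sup>+x. g x \<partial>\<nu>)" if [measurable]: "g \<in> borel_measurable borel" for g y
  proof -
    obtain z where z: "y = f z" using surj by (metis surjD)
    have "(\<integral>\<^sup>+x. g (x + y) \<partial>\<nu>) = (\<integral>\<^sup>+x. g (f x + f z) \<partial>lborel)"
      unfolding \<nu>_def z by (subst nn_integral_distr) auto
    also have "\<dots> = (\<integral>\<^sup>+x. g (f (z + x)) \<partial>lborel)" using lin by (simp add: linear_add add.commute)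
    also have "\<dots> = (\<integral>\<^sup>+x. g (f x) \<partial>distr lborel borel ((+) z))"
      by (subst nn_integral_distr) auto
    also have "\<dots> = (\<integral>\<^sup>+x. g x \<partial>\<nu>)"
      unfolding lborel_distr_plus \<nu>_def by (subst nn_integral_distr) auto
    finally show ?thesis .
  qed
  have trl: "(\<integral>\<^sup>+x. g (z + x) \<partial>lborel) = (\<integral>\<^sup>+x. g x \<partial>lborel)" if [measurable]: "g \<in> borel_measurable borel" for g and z :: 'a
  proof -
    have "(\<integral>\<^sup>+x. g (z + x) \<partial>lborel) = (\<integral>\<^sup>+x. g x \<partial>distr lborel borel ((+) z))"
      by (subst nn_integral_distr) auto
    then show ?thesis by (simp add: lborel_distr_plus)
  qed
  have neg: "(\<integral>\<^sup>+x. g (z - x) \<partial>lborel) = (\<integral>\<^sup>+x. g x \<partial>lborel)" if [measurable]: "g \<in> borel_measurable borel" for g and z :: 'a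
  proof -
    have "lborel = distr lborel borel (\<lambda>x::'a. z - x)"
      using lborel_affine[of "-1" z] by (simp add: density_1)
    then have "(\<integral>\<^sup>+x. g x \<partial>lborel) = (\<integral>\<^sup>+x. g x \<partial>distr lborel borel (\<lambda>x::'a. z - x))" by simp
    also have "\<dots> = (\<integral>\<^sup>+x. g (z - x) \<partial>lborel)" by (subst nn_integral_distr) auto
    finally show ?thesis by simp
  qed
  have key: "emeasure \<nu> A * emeasure lborel B = emeasure \<nu> B * emeasure lborel A"
    if [measurable]: "A \<in> sets borel" "B \<in> sets borel" for A B :: "'a set"
  proof -
    have "emeasure \<nu> A * emeasure lborel B
        = (\<integral>\<^sup>+x. indicator A x * (\<integral>\<^sup>+y. indicator B y \<partial>lborel) \<partial>\<nu>)"
      by (simp add: nn_integral_multc)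
    also have "\<dots> = (\<integral>\<^sup>+x. indicator A x * (\<integral>\<^sup>+y. indicator B (x + y) \<partial>lborel) \<partial>\<nu>)"
      by (subst trl) auto
    also have "\<dots> = (\<integral>\<^sup>+x. (\<integral>\<^sup>+y. indicator A x * indicator B (x + y) \<partial>lborel) \<partial>\<nu>)"
      by (subst nn_integral_cmult) auto
    also have "\<dots> = (\<integral>\<^sup>+y. (\<integral>\<^sup>+x. indicator A x * indicator B (x + y) \<partial>\<nu>) \<partial>lborel)"
      by (rule p.Fubini'[symmetric]) simp
    also have "\<dots> = (\<integral>\<^sup>+y. (\<integral>\<^sup>+x. indicator A (x - y) * indicator B x \<partial>\<nu>) \<partial>lborel)"
    proof (rule nn_integral_cong)
      fix y :: 'a
      show "(\<integral>\<^sup>+x. indicator A x * indicator B (x + y) \<partial>\<nu>) = (\<integral>\<^sup>+x. indicator A (x - y) * indicator B x \<partial>\<nu>)"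
        using tr[of "\<lambda>x. indicator A (x - y) * indicator B x" y] by simp
    qed
    also have "\<dots> = (\<integral>\<^sup>+x. (\<integral>\<^sup>+y. indicator A (x - y) * indicator B x \<partial>lborel) \<partial>\<nu>)"
      by (rule p.Fubini') simp
    also have "\<dots> = (\<integral>\<^sup>+x. (\<integral>\<^sup>+y. indicator A (x - y) \<partial>lborel) * indicator B x \<partial>\<nu>)"
      by (subst nn_integral_multc) auto
    also have "\<dots> = (\<integral>\<^sup>+x. emeasure lborel A * indicator B x \<partial>\<nu>)"
      by (subst neg) auto
    also have "\<dots> = emeasure \<nu> B * emeasure lborel A"
      by (subst nn_integral_cmult) (auto simp: mult.commute)
    finally show ?thesis .
  qed
  have "\<nu> = lborel"
  proof (rule measure_eqI)
    fix A :: "'a set" assume "A \<in> sets \<nu>"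
    then have "emeasure \<nu> A * emeasure lborel (ball (0::'a) 1) = emeasure lborel A * emeasure lborel (ball (0::'a) 1)"
      using key[of A "ball 0 1"] nuball[of 1] by (simp add: mult.commute)
    moreover have "emeasure lborel (ball (0::'a) 1) > 0" 
      using content_ball_pos[of 1 "0::'a"] by (auto simp: measure_def zero_less_iff_neq_zero)
    ultimately show "emeasure \<nu> A = emeasure lborel A"
      using finb[of 1] by (auto simp: mult.commute[of "emeasure _ A"] ennreal_mult_cancel_left less_top)
  qed simp
  then show ?thesis by (simp add: \<nu>_def)
qed

lemma uniform_on_sphere_exists:
  fixes L :: "'a::euclidean_space set"
  assumes L: "subspace L" and ne: "L \<noteq> {0}"
  shows "\<exists>\<mu>. uniform_on_sphere L \<mu>"
proof -
  let ?U = "uniform_measure lborel (ball (0::'a) 1)"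
  have cL: "convex L" "closed L" "L \<noteq> {}" "0 \<in> L"
    using L subspace_imp_convex closed_subspace subspace_0 by auto
  define q where "q = closest_point L"
  have qL: "q x \<in> L" for x using cL closest_point_in_set unfolding q_def by blast
  have qm[measurable]: "q \<in> borel_measurable borel"
    unfolding q_def using cL by (intro borel_measurable_continuous_onI continuous_on_closest_point)
  define p where "p = (\<lambda>x. inverse (norm (q x)) *\<^sub>R q x)"
  have pm[measurable]: "p \<in> borel_measurable borel" unfolding p_def by measurable
  have ball0: "emeasure lborel (ball (0::'a) 1) \<noteq> 0" "emeasure lborel (ball (0::'a) 1) \<noteq> \<infinity>"
    using content_ball_pos[of 1 "0::'a"] emeasure_bounded_finite[of "ball (0::'a) 1"]
    by (auto simp: measure_def)
  interpret U: prob_space ?U using ball0 by (intro prob_space_uniform_measure) auto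
  define \<mu> where "\<mu> = distr ?U borel p"
  interpret m: prob_space \<mu> unfolding \<mu>_def by (rule U.prob_space_distr) simp
  obtain a where a: "a \<in> L" "a \<noteq> 0" using ne cL by blast
  have q0: "a \<bullet> x = 0" if "q x = 0" for x
  proof -
    have "x \<bullet> a \<le> 0" using closest_point_dot[of L a x] cL a that unfolding q_def by simp
    moreover have "x \<bullet> (- a) \<le> 0"
      using closest_point_dot[of L "- a" x] cL a L that subspace_neg unfolding q_def by fastforce
    ultimately show ?thesis by (simp add: inner_commute)
  qed
  have "AE x in lborel. a \<bullet> x \<noteq> 0"
  proof -
    have "negligible {x. a \<bullet> x = 0}" using a by (intro negligible_hyperplane) auto
    then have "AE x in lebesgue. x \<notin> {x. a \<bullet> x = 0}"
      using AE_not_in negligible_iff_null_sets by blast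
    then show ?thesis by (simp add: AE_completion_iff)
  qed
  then have "AE x in ?U. a \<bullet> x \<noteq> 0" using ball0 by (subst AE_uniform_measure) (auto simp: less_top[symmetric])
  then have AE: "AE x in ?U. p x \<in> sphere 0 1 \<inter> L"
  proof eventually_elim
    case (elim x)
    then have "q x \<noteq> 0" using q0 by blast
    then show ?case using qL L by (simp add: p_def subspace_scale)
  qed
  have Sm[measurable]: "sphere 0 1 \<inter> L \<in> sets borel" using cL by auto
  have one: "measure \<mu> (sphere 0 1 \<inter> L) = 1"
  proof -
    have "AE x in \<mu>. x \<in> sphere 0 1 \<inter> L" unfolding \<mu>_def 
      by (rule iffD2[OF AE_distr_iff[where N=borel, OF _ _]]) (use Sm AE in \<open>simp_all only: Collect_mem_eq space_borel Set.UNIV_I simp_thms, simp_all\<close>)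
    then show ?thesis using m.prob_eq_1[of "sphere 0 1 \<inter> L"] by (simp add: \<mu>_def)
  qed
  have inv: "distr \<mu> borel f = \<mu>" if f: "orthogonal_transformation f" "f ` L = L" for f
  proof -
    have lin: "linear f" using f orthogonal_transformation_def by blast
    then have fm[measurable]: "f \<in> borel_measurable borel"
      by (simp add: borel_measurable_continuous_onI linear_continuous_on linear_linear)
    have nf: "norm (f x) = norm x" for x using f orthogonal_transformation_norm by blast
    have df: "dist (f x) (f y) = dist x y" for x y
      using nf lin by (metis dist_norm linear_diff)
    have "f (q x) = q (f x)" for x
      unfolding q_def
    proof (rule closest_point_unique)
      show "f (closest_point L x) \<in> L" using f(2) qL unfolding q_def by blast
      show "\<forall>z\<in>L. dist (f x) (f (closest_point L x)) \<le> dist (f x) z"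
      proof
        fix z assume "z \<in> L"
        then obtain y where "y \<in> L" "z = f y" using f(2) by blast
        then show "dist (f x) (f (closest_point L x)) \<le> dist (f x) z"
          using closest_point_le[of L y x] cL by (simp add: df)
      qed
    qed (use cL in auto)
    then have fp: "f (p x) = p (f x)" for x using lin by (simp add: p_def linear_cmul) (metis nf)
    have Uf: "distr ?U borel f = ?U"
    proof (rule measure_eqI)
      fix A assume "A \<in> sets (distr ?U borel f)"
      then have [measurable]: "A \<in> sets borel" by simp
      have "emeasure (distr ?U borel f) A = emeasure ?U (f -` A)"
        by (subst emeasure_distr) auto
      also have "\<dots> = emeasure lborel (ball 0 1 \<inter> f -` A) / emeasure lborel (ball (0::'a) 1)"
        using measurable_sets[OF fm, of A] by (subst emeasure_uniform_measure) auto
      also have "ball 0 1 \<inter> f -` A = f -` (ball 0 1 \<inter> A)" by (auto simp: nf)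
      also have "emeasure lborel (f -` (ball 0 1 \<inter> A)) = emeasure (distr lborel borel f) (ball 0 1 \<inter> A)"
        by (subst emeasure_distr) auto
      also have "\<dots> = emeasure lborel (ball 0 1 \<inter> A)" by (simp add: lborel_distr_orthogonal[OF f(1)])
      also have "\<dots> / emeasure lborel (ball (0::'a) 1) = emeasure ?U A" by (subst emeasure_uniform_measure) auto
      finally show "emeasure (distr ?U borel f) A = emeasure ?U A" .
    qed simp
    have "distr \<mu> borel f = distr ?U borel (f \<circ> p)" unfolding \<mu>_def by (subst distr_distr) auto
    also have "f \<circ> p = p \<circ> f" using fp by auto
    also have "distr ?U borel (p \<circ> f) = distr (distr ?U borel f) borel p" by (subst distr_distr) auto
    also have "\<dots> = \<mu>" unfolding Uf \<mu>_def ..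
    finally show ?thesis .
  qed
  have "uniform_on_sphere L \<mu>" unfolding uniform_on_sphere_def
    using m.prob_space_axioms one inv by (auto simp: \<mu>_def)
  then show ?thesis ..
qed

lemma uniform_on_sphere_sphere_measure:
  assumes "subspace L" "L \<noteq> {0}"
  shows "uniform_on_sphere L (sphere_measure L)"
  unfolding sphere_measure_def
  using uniform_on_sphere_exists[OF assms] uniform_on_sphere_unique[OF assms(1)]
  by (metis (no_types, lifting) theI)

end

theory Submission
  imports Defs
begin

text \<open>
  The external angle at a face \<open>F\<close> of a polytope is the probability that a Gaussian vector,
  projected to the linear hull of the normal cone at \<open>F\<close>, falls into this cone
  (\<open>solid_angle_eq_gauss\<close>). If \<open>F\<close> is spanned by the points \<open>X i\<close> with \<open>i \<in> I\<close>, the hull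
  consists of all \<open>w\<close> that are orthogonal to the differences of these points, and the cone of those
  \<open>w\<close> for which the numbers \<open>X k \<bullet> w\<close> are maximal at every index in \<open>I\<close>. If the points
  with index in \<open>I\<close> span no face and no other point lies in their affine hull, the same probability
  is 0, because the cone then has lower dimension. So the angle sum is a sum over index sets
  (\<open>angle_sum_eq\<close>), and in general position the index sets that occur are precisely those of
  size \<open>j + 1\<close>.

  Fix such an \<open>I\<close> and let \<open>w\<close> be the projected Gaussian vector. It depends on the differences of
  the points in \<open>I\<close> and on extra randomness, but not on their mean or on the other points, and
  for Gaussian points these are independent of the differences. Conditionally on \<open>w\<close>, scaled to
  length 1, the numbers \<open>X k \<bullet> w\<close> for \<open>k \<notin> I\<close> are therefore independent standard normal, and
  the common value of \<open>X i \<bullet> w\<close> for \<open>i \<in> I\<close> is an independent normal variable distributed as the mean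
  of \<open>j + 1\<close> standard normal variables. That is the law of a Gaussian vector in \<open>\<real>\<^sup>n\<close> projected to the
  subspace where the coordinates in \<open>I\<close> agree. This subspace is the linear hull of the normal cone of the
  regular simplex at the face with vertex set \<open>I\<close>, and that cone again consists of the vectors
  whose maximal coordinates include those in \<open>I\<close>. So the expected angle is the external angle of the simplex
  (\<open>nn_integral_angle\<close>, \<open>solid_angle_simplex_normal_cone\<close>), and there are \<open>n choose (j + 1)\<close>
  index sets.

  Independence of mean and differences enters through one invariance property: a linear map whose
  composition with its adjoint is the identity maps Gaussian measure to Gaussian measure
  (\<open>distr_gauss_coisometry\<close>). It allows resampling a matrix in two complementary subspaces
  (\<open>nn_integral_gauss_resample\<close>) and gives the law of a Gaussian matrix times a unit vector.

  The integral over the probability space requires the angle sum to be a measurable function of all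
  configurations, degenerate ones included. This is why the sum over index sets is proved for every
  configuration, and why projections are computed by Gram-Schmidt, which is jointly measurable in
  the configuration and the projected vector.
\<close>

section \<open>The standard Gaussian measure\<close>

definition gauss :: "'a::euclidean_space measure" where
  "gauss = density lborel (\<lambda>x. ennreal (\<Prod>b\<in>Basis. std_normal_density (x \<bullet> b)))"

lemma sets_gauss [simp, measurable_cong]: "sets gauss = sets borel"
  and space_gauss [simp]: "space gauss = UNIV"
  by (simp_all add: gauss_def)

abbreviation std_normal1 :: "real measure" where
  "std_normal1 \<equiv> density lborel std_normal_density"

lemma emeasure_gauss_box:
  "emeasure gauss (box l u :: 'a::euclidean_space set)
     = (\<Prod>b\<in>Basis. emeasure std_normal1 {l \<bullet> b<..<u \<bullet> b})"
proof -
  have ind: "indicator (box l u) x = (\<Prod>b\<in>Basis. indicator {l \<bullet> b<..<u \<bullet> b} (x \<bullet> b) :: ennreal)" for x :: 'a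
    by (auto simp: indicator_def box_def prod_zero_iff)
  have "emeasure gauss (box l u)
      = (\<integral>\<^sup>+x. (\<Prod>b\<in>Basis. ennreal (std_normal_density (x \<bullet> b)) * indicator {l \<bullet> b<..<u \<bullet> b} (x \<bullet> b)) \<partial>lborel)"
    by (simp add: gauss_def emeasure_density ind prod.distrib prod_ennreal)
  also have "\<dots> = (\<Prod>b\<in>Basis. \<integral>\<^sup>+x. ennreal (std_normal_density x) * indicator {l \<bullet> b<..<u \<bullet> b} x \<partial>lborel)"
    by (subst nn_integral_lborel_prod) simp_all
  finally show ?thesis by (simp add: emeasure_density)
qed

lemma emeasure_gauss_UNIV: "emeasure gauss (UNIV :: 'a::euclidean_space set) = 1"
proof -
  interpret N: prob_space std_normal1 by (rule prob_space_normal_density) simp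
  have "emeasure gauss (UNIV :: 'a set) = (\<integral>\<^sup>+x. (\<Prod>b\<in>Basis. ennreal (std_normal_density ((x::'a) \<bullet> b))) \<partial>lborel)"
    by (simp add: gauss_def emeasure_density prod_ennreal)
  also have "\<dots> = (\<Prod>b\<in>(Basis::'a set). emeasure std_normal1 UNIV)"
    by (subst nn_integral_lborel_prod) (simp_all add: emeasure_density)
  also have "\<dots> = 1" using N.emeasure_space_1 by simp
  finally show ?thesis .
qed

global_interpretation gauss: prob_space "gauss :: 'a::euclidean_space measure"
  by (rule prob_spaceI) (simp add: emeasure_gauss_UNIV)

text \<open>
  Boxes have product form in every space at hand, so this one criterion identifies product
  measures and laws of vectors with independent rows.
\<close>

lemma gauss_eqI:
  fixes \<nu> :: "'a::euclidean_space measure"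
  assumes sets: "sets \<nu> = sets borel"
    and box: "\<And>l u. box l u \<noteq> {} \<Longrightarrow>
      emeasure \<nu> (box l u) = (\<Prod>b\<in>Basis. emeasure std_normal1 {l \<bullet> b<..<u \<bullet> b})"
  shows "\<nu> = gauss"
proof (rule sym, rule measure_eqI_generator_eq)
  let ?E = "range (\<lambda>(a, b). box a b::'a set)"
  show "Int_stable ?E"
    by (auto simp: Int_stable_def box_Int_box)
  show "?E \<subseteq> Pow UNIV" "sets gauss = sigma_sets UNIV ?E" "sets \<nu> = sigma_sets UNIV ?E"
    by (simp_all add: borel_eq_box sets)
  let ?A = "\<lambda>n::nat. box (- (real n *\<^sub>R One)) (real n *\<^sub>R One) :: 'a set"
  show "range ?A \<subseteq> ?E" "(\<Union>i. ?A i) = UNIV"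
    unfolding UN_box_eq_UNIV by auto
  show "emeasure gauss (?A i) \<noteq> \<infinity>" for i by simp
  show "emeasure gauss X = emeasure \<nu> X" if "X \<in> ?E" for X
  proof -
    from that obtain a b where X: "X = box a b" by auto
    show ?thesis
      using box[of a b] by (cases "X = {}") (simp_all add: X emeasure_gauss_box del: box_eq_empty)
  qed
qed

lemma AE_gauss_hyperplane:
  fixes a :: "'a::euclidean_space"
  assumes "a \<noteq> 0"
  shows "AE x in gauss. a \<bullet> x \<noteq> b"
proof -
  have "negligible {x. a \<bullet> x = b}" using assms by (intro negligible_hyperplane) auto
  then have "AE x in lebesgue. x \<notin> {x. a \<bullet> x = b}"
    using AE_not_in negligible_iff_null_sets by blast
  then have "AE x in lborel. a \<bullet> x \<noteq> b" by (simp add: AE_completion_iff)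
  then show ?thesis unfolding gauss_def by (subst AE_density) auto
qed

lemma gauss_pair: "gauss \<Otimes>\<^sub>M gauss = (gauss :: ('a::euclidean_space \<times> 'b::euclidean_space) measure)"
proof (rule gauss_eqI)
  show "sets (gauss \<Otimes>\<^sub>M gauss) = sets (borel :: ('a \<times> 'b) measure)"
    by (metis borel_prod sets_gauss sets_pair_measure_cong)
  show "emeasure (gauss \<Otimes>\<^sub>M gauss) (box l u) = (\<Prod>b\<in>Basis. emeasure std_normal1 {l \<bullet> b<..<u \<bullet> b})"
    for l u :: "'a \<times> 'b"
  proof -
    have "(\<Prod>b\<in>Basis. emeasure std_normal1 {l \<bullet> b<..<u \<bullet> b})
        = (\<Prod>b\<in>Basis. emeasure std_normal1 {fst l \<bullet> b<..<fst u \<bullet> b})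
          * (\<Prod>b\<in>Basis. emeasure std_normal1 {snd l \<bullet> b<..<snd u \<bullet> b})"
      unfolding Basis_prod_def
      by (subst prod.union_disjoint)
        (auto simp: inner_prod_def prod.reindex inj_on_def)
    then show ?thesis
      by (simp add: box_prod gauss.emeasure_pair_measure_Times emeasure_gauss_box)
  qed
qed

text \<open>
  The density depends on the norm only, and Lebesgue measure is rotation invariant.
\<close>

lemma distr_gauss_orthogonal:
  fixes f :: "'a::euclidean_space \<Rightarrow> 'a"
  assumes f: "orthogonal_transformation f"
  shows "distr gauss borel f = gauss"
proof -
  have lin: "linear f" using f orthogonal_transformation_def by blast
  then have fm[measurable]: "f \<in> borel_measurable borel"
    by (simp add: borel_measurable_continuous_onI linear_continuous_on linear_linear)
  define g :: "'a \<Rightarrow> ennreal" where "g x = ennreal (\<Prod>b\<in>Basis. std_normal_density (x \<bullet> b))" for x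
  have [measurable]: "g \<in> borel_measurable borel" unfolding g_def by simp
  have g: "g x = ennreal ((1 / sqrt (2 * pi)) ^ DIM('a) * exp (- (norm x)\<^sup>2 / 2))" for x
  proof -
    have "(norm x)\<^sup>2 = (\<Sum>b\<in>Basis. (x \<bullet> b)\<^sup>2)"
      unfolding power2_norm_eq_inner by (subst euclidean_inner) (simp add: power2_eq_square)
    then have "exp (- (norm x)\<^sup>2 / 2) = (\<Prod>b\<in>Basis. exp (- (x \<bullet> b)\<^sup>2 / 2))"
      by (simp add: exp_sum[symmetric] sum_negf sum_divide_distrib)
    then show ?thesis
      by (simp add: g_def std_normal_density_def prod.distrib prod_dividef prod_constant power_one_over divide_simps)
  qed
  have gf: "g (f x) = g x" for x
    using orthogonal_transformation_norm[OF f] by (simp add: g)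
  have G: "gauss = density lborel g" by (simp add: gauss_def g_def[abs_def])
  have "distr gauss borel f = distr (density lborel (\<lambda>x. g (f x))) borel f"
    by (simp add: gf G)
  also have "\<dots> = density (distr lborel borel f) g"
    by (subst density_distr) auto
  also have "\<dots> = gauss" by (simp add: lborel_distr_orthogonal[OF f] G)
  finally show ?thesis .
qed

text \<open>
  Here \<open>S\<close> is the adjoint of \<open>T\<close> and \<open>T S\<close> is the identity. On the product space,
  \<open>(x, g) \<mapsto> (x - S T x + S g, T x)\<close> replaces the component of \<open>x\<close> in the range of \<open>S\<close> by a
  fresh one and is orthogonal; its second component is \<open>T x\<close>. So the law of \<open>T x\<close> is that of the
  second coordinate of a Gaussian pair.
\<close>

lemma distr_gauss_coisometry:
  fixes T :: "'a::euclidean_space \<Rightarrow> 'b::euclidean_space"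
  assumes T: "linear T" and adj: "\<And>x y. T x \<bullet> y = x \<bullet> S y" and TS: "\<And>y. T (S y) = y"
  shows "distr gauss borel T = gauss"
proof -
  have S: "linear S"
    by (rule linearI) (rule vector_eq_ldot[THEN iffD1], simp add: adj[symmetric] inner_add_right)+
  have Tm[measurable]: "T \<in> borel_measurable borel"
    using T by (simp add: borel_measurable_continuous_onI linear_continuous_on linear_linear)
  define R :: "'a \<times> 'b \<Rightarrow> 'a \<times> 'b" where "R = (\<lambda>(x, g). (x - S (T x) + S g, T x))"
  have adj': "S y \<bullet> x = y \<bullet> T x" for x y by (metis adj inner_commute)
  have linR: "linear R" 
    by (rule linearI)
      (auto simp: R_def linear_add[OF T] linear_add[OF S] linear_cmul[OF T] linear_cmul[OF S] algebra_simps)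
  have innR: "R (x, g) \<bullet> R (y, h) = (x, g) \<bullet> (y, h)" for x g y h
  proof -
    define v where "v = y - S (T y) + S h"
    have Tv: "T v = h" by (simp add: v_def linear_add[OF T] linear_diff[OF T] TS)
    have "(x - S (T x) + S g) \<bullet> v = x \<bullet> v - T x \<bullet> h + g \<bullet> h"
      by (simp add: inner_add_left inner_diff_left adj' Tv)
    also have "x \<bullet> v = x \<bullet> y - T x \<bullet> T y + T x \<bullet> h"
      by (simp add: v_def inner_add_right inner_diff_right adj)
    finally show ?thesis by (simp add: R_def v_def)
  qed
  have orth: "orthogonal_transformation R"
    using linR innR by (auto simp: orthogonal_transformation_def)
  have Rm[measurable]: "R \<in> borel_measurable borel"
    using linR by (simp add: borel_measurable_continuous_onI linear_continuous_on linear_linear)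
  have m1: "fst \<in> measurable (borel :: ('a \<times> 'b) measure) borel"
    and m2: "snd \<in> measurable (borel :: ('a \<times> 'b) measure) borel"
    by (simp_all add: borel_prod[symmetric])
  note [measurable] = m1 m2
  have fst: "distr (gauss :: ('a \<times> 'b) measure) borel fst = gauss"
  proof (rule measure_eqI)
    fix A :: "'a set" assume "A \<in> sets (distr (gauss :: ('a \<times> 'b) measure) borel fst)"
    then have A: "A \<in> sets borel" by simp
    then have "emeasure (distr (gauss :: ('a \<times> 'b) measure) borel fst) A = emeasure (gauss \<Otimes>\<^sub>M gauss) (A \<times> (UNIV :: 'b set))"
      unfolding gauss_pair by (subst emeasure_distr) (auto intro!: arg_cong[where f="emeasure gauss"])
    then show "emeasure (distr (gauss :: ('a \<times> 'b) measure) borel fst) A = emeasure gauss A"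
      using A by (simp add: gauss.emeasure_pair_measure_Times emeasure_gauss_UNIV)
  qed simp
  have snd: "distr (gauss :: ('a \<times> 'b) measure) borel snd = gauss"
  proof (rule measure_eqI)
    fix A :: "'b set" assume "A \<in> sets (distr (gauss :: ('a \<times> 'b) measure) borel snd)"
    then have A: "A \<in> sets borel" by simp
    then have "emeasure (distr (gauss :: ('a \<times> 'b) measure) borel snd) A = emeasure (gauss \<Otimes>\<^sub>M gauss) ((UNIV :: 'a set) \<times> A)"
      unfolding gauss_pair by (subst emeasure_distr) (auto intro!: arg_cong[where f="emeasure gauss"])
    then show "emeasure (distr (gauss :: ('a \<times> 'b) measure) borel snd) A = emeasure gauss A"
      using A by (simp add: gauss.emeasure_pair_measure_Times emeasure_gauss_UNIV)
  qed simp
  have "distr gauss borel T = distr (distr (gauss :: ('a \<times> 'b) measure) borel fst) borel T"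
    by (simp add: fst)
  also have "\<dots> = distr (gauss :: ('a \<times> 'b) measure) borel (T \<circ> fst)" by (subst distr_distr) auto
  also have "T \<circ> fst = snd \<circ> R" by (auto simp: R_def)
  also have "distr gauss borel (snd \<circ> R) = distr (distr gauss borel R) borel snd"
    by (subst distr_distr) auto
  also have "\<dots> = gauss" by (simp add: distr_gauss_orthogonal[OF orth] snd)
  finally show ?thesis .
qed

section \<open>Orthogonal projections and solid angles\<close>

text \<open>
  The component of \<open>z\<close> orthogonal to the vectors of a list, by Gram-Schmidt. Unlike an abstract
  projection, this recursion is visibly Borel in the vectors as well as in \<open>z\<close>. A vector that
  depends linearly on its successors has residual 0 and contributes nothing, because
  \<open>a / 0 = 0\<close>.
\<close>

fun resid :: "'a::real_inner list \<Rightarrow> 'a \<Rightarrow> 'a" where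
  "resid [] z = z"
| "resid (v # vs) z = resid vs z
     - ((resid vs z \<bullet> resid vs v) / (resid vs v \<bullet> resid vs v)) *\<^sub>R resid vs v"

lemma resid_diff_in_span: "z - resid vs z \<in> span (set vs)"
proof (induction vs arbitrary: z)
  case (Cons v vs)
  let ?S = "span (set (v # vs))"
  have mono: "span (set vs) \<subseteq> ?S" by (intro span_mono) auto
  have d: "v - resid vs v \<in> ?S" and v: "v \<in> ?S"
    using Cons.IH[of v] mono by (auto intro: span_base)
  have "resid vs v \<in> ?S" using span_diff[OF v d] by simp
  then have "(z - resid vs z) + c *\<^sub>R resid vs v \<in> ?S" for c
    using Cons.IH[of z] mono by (intro span_add span_scale) auto
  then show ?case by (simp add: algebra_simps)
qed simp

lemma resid_orth:
  assumes "y \<in> span (set vs)"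
  shows "resid vs z \<bullet> y = 0"
proof -
  have "resid vs z \<bullet> y = 0" if "y \<in> set vs" for z y
    using that
  proof (induction vs arbitrary: z y)
    case (Cons v vs)
    have span0: "resid vs z \<bullet> y = 0" if "y \<in> span (set vs)" for z y
      using that by (induction rule: span_induct_alt) (auto simp: inner_add_right Cons.IH)
    show ?case
    proof (cases "y = v")
      case False
      then show ?thesis using Cons by (simp add: inner_diff_left)
    next
      case True
      define b where "b = resid vs v"
      have eq: "v = b + (v - b)" by simp
      have ro: "resid vs w \<bullet> (v - b) = 0" for w
        using span0[of "v - b" w] resid_diff_in_span[of v vs] by (simp add: b_def)
      have rb: "resid vs w \<bullet> v = resid vs w \<bullet> b" for w
        using ro[of w] by (simp add: inner_diff_right)
      have "b \<bullet> v = b \<bullet> b" using rb[of v] by (simp add: b_def)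
      then show ?thesis
        by (cases "b = 0") (simp_all add: True inner_diff_left rb b_def[symmetric])
    qed
  qed simp
  note * = this
  show ?thesis
    using assms by (induction rule: span_induct_alt) (auto simp: inner_add_right *)
qed

lemma resid_eq_0_iff: "resid vs z = 0 \<longleftrightarrow> z \<in> span (set vs)"
proof
  assume "resid vs z = 0"
  then show "z \<in> span (set vs)" using resid_diff_in_span[of z vs] by simp
next
  assume z: "z \<in> span (set vs)"
  then have "resid vs z \<in> span (set vs)"
    using resid_diff_in_span[of z vs] span_diff by fastforce
  then show "resid vs z = 0" using resid_orth[of "resid vs z" vs z] by simp
qed

lemma measurable_resid [measurable]:
  fixes f :: "'i \<Rightarrow> 'b \<Rightarrow> 'a::euclidean_space"
  assumes f: "\<And>i. f i \<in> borel_measurable N" and g[measurable]: "g \<in> borel_measurable N"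
  shows "(\<lambda>x. resid (map (\<lambda>i. f i x) is) (g x)) \<in> borel_measurable N"
  using g
proof (induction "is" arbitrary: g)
  case (Cons i "is")
  note [measurable] = Cons.IH[OF Cons.prems] Cons.IH[OF f[of i]]
  show ?case by simp
qed simp

definition orth_proj_on :: "'a::real_inner set \<Rightarrow> ('a \<Rightarrow> 'a) \<Rightarrow> bool" where
  "orth_proj_on L p \<longleftrightarrow> subspace L \<and> (\<forall>z. p z \<in> L \<and> (\<forall>y\<in>L. p z \<bullet> y = z \<bullet> y))"

lemma orth_proj_onD:
  assumes "orth_proj_on L p"
  shows "subspace L" "p z \<in> L" "y \<in> L \<Longrightarrow> p z \<bullet> y = z \<bullet> y"
  using assms by (auto simp: orth_proj_on_def)

lemma orth_proj_on_unique:
  assumes p: "orth_proj_on L p" and q: "q \<in> L" "\<And>y. y \<in> L \<Longrightarrow> q \<bullet> y = z \<bullet> y"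
  shows "p z = q"
proof -
  have d: "p z - q \<in> L" using orth_proj_onD[OF p] q(1) by (simp add: subspace_diff)
  have "(p z - q) \<bullet> (p z - q) = 0"
    using orth_proj_onD(3)[OF p d, of z] q(2)[OF d] by (simp add: inner_diff_left)
  then show ?thesis by simp
qed

lemma orth_proj_on_self: "orth_proj_on L p \<Longrightarrow> z \<in> L \<Longrightarrow> p z = z"
  by (rule orth_proj_on_unique) auto

lemma orth_proj_on_inner:
  assumes p: "orth_proj_on L p"
  shows "p x \<bullet> y = x \<bullet> p y"
proof -
  note pD = orth_proj_onD[OF p]
  have "p x \<bullet> y = p y \<bullet> p x" using pD(3)[OF pD(2)[of x], of y] by (simp add: inner_commute)
  also have "\<dots> = x \<bullet> p y" using pD(3)[OF pD(2)[of y], of x] by (simp add: inner_commute)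
  finally show ?thesis .
qed

lemma orth_proj_on_linear:
  assumes p: "orth_proj_on L p"
  shows "linear p"
proof (rule linearI)
  note pD = orth_proj_onD[OF p]
  show "p (x + y) = p x + p y" for x y
    using pD by (intro orth_proj_on_unique[OF p]) (simp_all add: subspace_add inner_add_left)
  show "p (c *\<^sub>R x) = c *\<^sub>R p x" for c x
    using pD by (intro orth_proj_on_unique[OF p]) (simp_all add: subspace_scale)
qed

lemma borel_measurable_linear:
  fixes f :: "'a::euclidean_space \<Rightarrow> 'b::euclidean_space"
  shows "linear f \<Longrightarrow> f \<in> borel_measurable borel"
  by (simp add: borel_measurable_continuous_onI linear_continuous_on linear_linear)

lemma AE_gauss_orth_proj_inner:
  fixes L :: "'a::euclidean_space set"
  assumes p: "orth_proj_on L p" and a: "p a \<noteq> 0"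
  shows "AE z in gauss. p z \<bullet> a \<noteq> 0"
proof -
  have "p z \<bullet> a = p a \<bullet> z" for z
    using orth_proj_on_inner[OF p, of z a] by (simp add: inner_commute)
  then show ?thesis using AE_gauss_hyperplane[OF a, of 0] by simp
qed

text \<open>
  The direction of the projected Gaussian vector \<open>p z\<close> is uniform on the unit sphere of \<open>L\<close>: it is
  almost surely defined, and isometries that preserve \<open>L\<close> commute with \<open>p\<close> and preserve the
  Gaussian measure. Since \<open>C\<close> is a cone, only this direction matters. If \<open>C\<close> is a subspace, then
  \<open>C = L\<close> and both sides are 1.
\<close>

lemma solid_angle_eq_gauss:
  fixes C L :: "'a::euclidean_space set"
  assumes p: "orth_proj_on L p" and span: "span C = L"
    and C: "closed C" "cone C" "C \<noteq> {}"
  shows "solid_angle C = measure gauss {z. p z \<in> C}"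
proof (cases "subspace C")
  case True
  then have "C = L" using span span_eq_iff[of C] by simp
  then show ?thesis using True orth_proj_onD(2)[OF p] gauss.prob_space by (simp add: solid_angle_def)
next
  case False
  note pD = orth_proj_onD[OF p]
  have C0: "0 \<in> C" using C by (simp add: cone_contains_0)
  have L0: "L \<noteq> {0}"
  proof
    assume "L = {0}"
    then have "C = {0}" using span C0 span_base[of _ C] by auto
    then show False using False subspace_0 by (simp add: subspace_single_0)
  qed
  have [measurable]: "p \<in> borel_measurable borel"
    by (intro borel_measurable_linear orth_proj_on_linear[OF p])
  have [measurable]: "C \<in> sets borel" using C by simp
  have Lm[measurable]: "L \<in> sets borel" using pD(1) by (simp add: closed_subspace)
  define q where "q = (\<lambda>z. inverse (norm (p z)) *\<^sub>R p z)"
  have qm[measurable]: "q \<in> borel_measurable borel" unfolding q_def by measurable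
  have pC: "p z \<in> C \<longleftrightarrow> q z \<in> C" for z
  proof (cases "p z = 0")
    case False
    then have "norm (p z) *\<^sub>R q z = p z" by (simp add: q_def)
    moreover have "c *\<^sub>R x \<in> C" if "x \<in> C" "c \<ge> 0" for c x
      using C(2) that by (simp add: cone_def)
    ultimately show ?thesis
      by (metis norm_ge_zero inverse_nonnegative_iff_nonnegative q_def)
  qed (simp add: q_def)
  define \<mu> where "\<mu> = distr gauss borel q"
  interpret m: prob_space \<mu> unfolding \<mu>_def by (rule gauss.prob_space_distr) simp
  have "uniform_on_sphere L \<mu>"
    unfolding uniform_on_sphere_def
  proof (intro conjI allI impI)
    show "prob_space \<mu>" by (fact m.prob_space_axioms)
    show "sets \<mu> = sets borel" by (simp add: \<mu>_def)
    obtain a where a: "a \<in> L" "a \<noteq> 0" using L0 subspace_0[OF pD(1)] by auto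
    have "AE z in gauss. p z \<bullet> a \<noteq> 0"
      by (rule AE_gauss_orth_proj_inner[OF p]) (simp add: orth_proj_on_self[OF p a(1)] a)
    then have AEq: "AE z in gauss. q z \<in> sphere 0 1 \<inter> L"
    proof eventually_elim
      case (elim z)
      then have "p z \<noteq> 0" by auto
      then show ?case using pD(1) pD(2)[of z] by (simp add: q_def subspace_scale)
    qed
    have Sm[measurable]: "sphere 0 1 \<inter> L \<in> sets borel" by simp
    have "measure \<mu> (sphere 0 1 \<inter> L) = measure gauss (q -` (sphere 0 1 \<inter> L))"
      unfolding \<mu>_def by (subst measure_distr) auto
    also have "\<dots> = 1"
      using AEq measurable_sets[OF qm Sm] by (subst gauss.prob_eq_1) (auto simp: vimage_def)
    finally show "measure \<mu> (sphere 0 1 \<inter> L) = 1" .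
    fix f assume f: "orthogonal_transformation f \<and> f ` L = L"
    then have lin: "linear f" and orth: "\<And>x y. f x \<bullet> f y = x \<bullet> y"
      by (auto simp: orthogonal_transformation_def)
    note [measurable] = borel_measurable_linear[OF lin]
    have "p (f z) = f (p z)" for z
    proof (rule orth_proj_on_unique[OF p])
      show "f (p z) \<in> L" using imageI[OF pD(2)[of z], of f] f by simp
      show "f (p z) \<bullet> y = f z \<bullet> y" if "y \<in> L" for y
      proof -
        have "y \<in> f ` L" using that f by simp
        then obtain y' where y: "y = f y'" "y' \<in> L" by (rule imageE)
        show ?thesis unfolding y(1) orth by (rule pD(3)[OF y(2)])
      qed
    qed
    then have "f (q z) = q (f z)" for z
      using orthogonal_transformation_norm[OF conjunct1[OF f], of "p z"]
      by (simp add: q_def linear_cmul[OF lin])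
    then have fq: "f \<circ> q = q \<circ> f" by auto
    have "distr \<mu> borel f = distr gauss borel (f \<circ> q)"
      unfolding \<mu>_def by (subst distr_distr) auto
    also have "\<dots> = distr (distr gauss borel f) borel q"
      unfolding fq by (subst distr_distr) auto
    also have "\<dots> = \<mu>" using f by (simp add: distr_gauss_orthogonal \<mu>_def)
    finally show "distr \<mu> borel f = \<mu>" .
  qed
  then have "sphere_measure L = \<mu>"
    using uniform_on_sphere_unique[OF pD(1)] uniform_on_sphere_sphere_measure[OF pD(1) L0] by blast
  then have "solid_angle C = measure \<mu> C" using False span by (simp add: solid_angle_def)
  also have "\<dots> = measure gauss {z. p z \<in> C}"
    unfolding \<mu>_def by (subst measure_distr) (auto simp: pC vimage_def)
  finally show ?thesis .
qed

section \<open>Faces and normal cones of a finite configuration\<close>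

definition max_cone :: "'n::finite set \<Rightarrow> (real ^ 'n) set" where
  "max_cone I = {v. \<forall>i\<in>I. \<forall>k. v $ k \<le> v $ i}"

text \<open>
  The points of a configuration are the rows of a matrix \<open>x\<close>, so that \<open>x *v w\<close> lists the values of a
  linear functional \<open>w\<close> at the points. All normal cones are thus preimages of the cones \<open>max_cone I\<close>,
  which are themselves the normal cones of the regular simplex.
\<close>

definition level :: "real ^ 'd ^ 'n::finite \<Rightarrow> 'n set \<Rightarrow> (real ^ 'd) set" where
  "level x I = {w. \<forall>i\<in>I. \<forall>k\<in>I. x $ i \<bullet> w = x $ k \<bullet> w}"

definition ncone :: "real ^ 'd ^ 'n::finite \<Rightarrow> 'n set \<Rightarrow> (real ^ 'd) set" where
  "ncone x I = {w. x *v w \<in> max_cone I}"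

lemma mem_ncone: "w \<in> ncone x I \<longleftrightarrow> (\<forall>i\<in>I. \<forall>k. x $ k \<bullet> w \<le> x $ i \<bullet> w)"
  by (simp add: ncone_def max_cone_def matrix_vector_mul_component)

abbreviation pts :: "'a ^ 'n::finite \<Rightarrow> 'n set \<Rightarrow> 'a set" where
  "pts x I \<equiv> (\<lambda>i. x $ i) ` I"

lemma levelD: "w \<in> level x I \<Longrightarrow> i \<in> I \<Longrightarrow> k \<in> I \<Longrightarrow> x $ i \<bullet> w = x $ k \<bullet> w"
  unfolding level_def by blast

lemma subspace_level: "subspace (level x I)"
proof (rule subspaceI)
  show "u + v \<in> level x I" if "u \<in> level x I" "v \<in> level x I" for u v
    unfolding level_def
    using levelD[OF that(1)] levelD[OF that(2)] by (intro CollectI ballI) (metis inner_add_right)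
  show "c *\<^sub>R u \<in> level x I" if "u \<in> level x I" for c u
    unfolding level_def using levelD[OF that] by (intro CollectI ballI) (metis inner_scaleR_right)
qed (simp add: level_def)

lemma ncone_subset_level: "ncone x I \<subseteq> level x I"
proof
  fix w assume w: "w \<in> ncone x I"
  have "x $ i \<bullet> w = x $ k \<bullet> w" if "i \<in> I" "k \<in> I" for i k
    using w that unfolding mem_ncone by (intro order_antisym) blast+
  then show "w \<in> level x I" unfolding level_def by blast
qed

lemma closed_ncone: "closed (ncone x I)"
proof -
  have "ncone x I = (\<Inter>i\<in>I. \<Inter>k. {w. x $ k \<bullet> w \<le> x $ i \<bullet> w})"
    by (auto simp: mem_ncone)
  then show ?thesis
    by (auto intro!: closed_INT closed_Collect_le continuous_intros)
qed

lemma cone_ncone: "cone (ncone x I)"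
  by (auto simp: cone_def mem_ncone intro!: mult_left_mono)

lemma zero_in_ncone: "0 \<in> ncone x I"
  by (simp add: mem_ncone)

text \<open>
  A functional that is maximal over the hull of the chosen points at one of its relative interior
  points is constant on that hull, so a normal vector is maximal at all of the chosen points.
\<close>

lemma normal_cone_convex_hull:
  fixes x :: "real ^ 'd ^ 'n::finite"
  assumes "I \<noteq> {}"
  shows "normal_cone (convex hull pts x I) (convex hull pts x UNIV) = ncone x I"
    (is "normal_cone ?F ?P = _")
proof (rule set_eqI, rule iffI)
  fix w assume w: "w \<in> normal_cone ?F ?P"
  obtain f where f: "f \<in> rel_interior ?F"
    using assms rel_interior_eq_empty[of ?F] by (auto simp: convex_convex_hull)
  have fF: "f \<in> ?F" using f rel_interior_subset by blast
  have le: "y \<bullet> w \<le> f \<bullet> w" if "y \<in> ?P" for y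
  proof -
    have "y - f \<in> tangent_cone ?F ?P"
      unfolding tangent_cone_def using f that by (auto intro!: bexI[of _ f] exI[of _ 1])
    then show ?thesis using w unfolding normal_cone_def
      by (auto simp: inner_diff_right inner_commute)
  qed
  have row: "x $ k \<in> ?P" for k by (intro hull_inc) auto
  have ge: "f \<bullet> w \<le> x $ i \<bullet> w" if "i \<in> I" for i
  proof -
    have "x $ i \<in> ?F" using that by (intro hull_inc) auto
    \<comment> \<open>As \<open>f\<close> is in the relative interior, the segment from \<open>x $ i\<close> to \<open>f\<close> extends beyond \<open>f\<close> in the hull.\<close>
    then obtain m where m: "m > 1" "(1 - m) *\<^sub>R x $ i + m *\<^sub>R f \<in> ?F"
      using convex_rel_interior_iff[of ?F f] f fF assms by (auto simp: convex_convex_hull)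
    have "?F \<subseteq> ?P" by (intro hull_mono) auto
    then have "((1 - m) *\<^sub>R x $ i + m *\<^sub>R f) \<bullet> w \<le> f \<bullet> w" using le m(2) by blast
    then have "(m - 1) * (f \<bullet> w) \<le> (m - 1) * (x $ i \<bullet> w)"
      by (simp add: inner_add_left algebra_simps)
    then show ?thesis using m(1) by simp
  qed
  show "w \<in> ncone x I"
    using le[OF row] ge by (auto simp: mem_ncone intro: order_trans)
next
  fix w assume w: "w \<in> ncone x I"
  obtain i where i: "i \<in> I" using assms by blast
  define c where "c = x $ i \<bullet> w"
  have "?P \<subseteq> {y. w \<bullet> y \<le> c}"
    using w i by (intro hull_minimal convex_halfspace_le) (auto simp: mem_ncone c_def inner_commute)
  then have P: "y \<bullet> w \<le> c" if "y \<in> ?P" for y using that by (auto simp: inner_commute)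
  have "?F \<subseteq> {y. w \<bullet> y = c}"
  proof (intro hull_minimal convex_hyperplane)
    have "w \<in> level x I" using w ncone_subset_level by blast
    from levelD[OF this _ i] show "pts x I \<subseteq> {y. w \<bullet> y = c}"
      by (auto simp: c_def inner_commute[of w])
  qed
  then have F: "y \<bullet> w = c" if "y \<in> ?F" for y using that by (auto simp: inner_commute)
  show "w \<in> normal_cone ?F ?P"
    unfolding normal_cone_def
  proof (intro CollectI ballI)
    fix u assume "u \<in> tangent_cone ?F ?P"
    then obtain f e where fe: "f \<in> rel_interior ?F" "e > 0" "f + e *\<^sub>R u \<in> ?P"
      unfolding tangent_cone_def by blast
    have "(f + e *\<^sub>R u) \<bullet> w \<le> f \<bullet> w" using P[OF fe(3)] F fe(1) rel_interior_subset by fastforce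
    then have "e * (u \<bullet> w) \<le> 0" by (simp add: inner_add_left)
    then show "w \<bullet> u \<le> 0" using fe(2) by (simp add: mult_le_0_iff inner_commute)
  qed
qed

text \<open>
  Strictness is what makes the points in \<open>I\<close> span a face, and what gives the normal cone full dimension
  in the level space.
\<close>

definition supports :: "real ^ 'd ^ 'n::finite \<Rightarrow> 'n set \<Rightarrow> real ^ 'd \<Rightarrow> bool" where
  "supports x I w \<longleftrightarrow> w \<in> level x I \<and> (\<forall>i\<in>I. \<forall>k\<in>-I. x $ k \<bullet> w < x $ i \<bullet> w)"

text \<open>
  If \<open>w\<close> is strictly supporting, then so is \<open>w + t y\<close> for every \<open>y\<close> in the level space and small
  \<open>t > 0\<close>. Hence the normal cone has nonempty interior relative to the level space.
\<close>

lemma span_ncone: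
  assumes w: "supports x I w"
  shows "span (ncone x I) = level x I"
proof (rule antisym)
  show "span (ncone x I) \<subseteq> level x I"
    using ncone_subset_level subspace_level by (rule span_minimal)
  show "level x I \<subseteq> span (ncone x I)"
  proof
    fix y assume y: "y \<in> level x I"
    \<comment> \<open>The finitely many strict inequalities between points inside and outside \<open>I\<close> are stable under a small perturbation.\<close>
    have "\<forall>\<^sub>F t in at_right (0::real). \<forall>p\<in>I \<times> -I. t * ((x $ snd p - x $ fst p) \<bullet> y) < (x $ fst p - x $ snd p) \<bullet> w"
    proof (rule eventually_ball_finite)
      show "finite (I \<times> -I)" by simp
      show "\<forall>p\<in>I \<times> -I. \<forall>\<^sub>F t in at_right (0::real). t * ((x $ snd p - x $ fst p) \<bullet> y) < (x $ fst p - x $ snd p) \<bullet> w"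
      proof
        fix p assume "p \<in> I \<times> -I"
        then have "0 < (x $ fst p - x $ snd p) \<bullet> w"
          using w by (auto simp: supports_def inner_diff_left)
        moreover have "((\<lambda>t. t * ((x $ snd p - x $ fst p) \<bullet> y)) \<longlongrightarrow> 0 * ((x $ snd p - x $ fst p) \<bullet> y)) (at_right (0::real))"
          by (intro tendsto_intros)
        ultimately show "\<forall>\<^sub>F t in at_right (0::real). t * ((x $ snd p - x $ fst p) \<bullet> y) < (x $ fst p - x $ snd p) \<bullet> w"
          by (intro order_tendstoD(2)[where y=0]) simp_all
      qed
    qed
    then have "\<forall>\<^sub>F t in at_right (0::real). t > 0 \<and> (\<forall>p\<in>I \<times> -I. t * ((x $ snd p - x $ fst p) \<bullet> y) < (x $ fst p - x $ snd p) \<bullet> w)"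
      using eventually_at_right_less[of "0::real"] by eventually_elim simp
    then have "\<exists>t>0. \<forall>p\<in>I \<times> -I. t * ((x $ snd p - x $ fst p) \<bullet> y) < (x $ fst p - x $ snd p) \<bullet> w"
      by (intro eventually_happens'[OF trivial_limit_at_right_real])
    then obtain t where t: "t > 0" "\<And>i k. i \<in> I \<Longrightarrow> k \<notin> I \<Longrightarrow> t * ((x $ k - x $ i) \<bullet> y) < (x $ i - x $ k) \<bullet> w"
      by fastforce
    have "w + t *\<^sub>R y \<in> ncone x I"
      unfolding mem_ncone
    proof (intro ballI allI)
      fix i k assume i: "i \<in> I"
      show "x $ k \<bullet> (w + t *\<^sub>R y) \<le> x $ i \<bullet> (w + t *\<^sub>R y)"
      proof (cases "k \<in> I")
        case True
        have "w + t *\<^sub>R y \<in> level x I"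
          using w y subspace_level by (auto simp: supports_def intro: subspace_add subspace_scale)
        then have "x $ k \<bullet> (w + t *\<^sub>R y) = x $ i \<bullet> (w + t *\<^sub>R y)"
          using True i by (rule levelD)
        then show ?thesis by simp
      next
        case False
        then show ?thesis using t(2)[OF i False] by (simp add: inner_add_right inner_diff_left algebra_simps)
      qed
    qed
    moreover have "w \<in> ncone x I"
      unfolding mem_ncone
    proof (intro ballI allI)
      fix i k assume i: "i \<in> I"
      show "x $ k \<bullet> w \<le> x $ i \<bullet> w"
        using w i levelD[of w x I k i] by (cases "k \<in> I") (auto simp: supports_def less_imp_le)
    qed
    ultimately have "(1 / t) *\<^sub>R ((w + t *\<^sub>R y) - w) \<in> span (ncone x I)"
      by (intro span_scale span_diff span_base)
    then show "y \<in> span (ncone x I)" using t(1) by simp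
  qed
qed

text \<open>
  Faces of polytopes are exposed, and the exposing functional is strict at the other points.
\<close>

lemma exists_supports_if_face:
  fixes x :: "real ^ 'd ^ 'n::finite"
  assumes face: "convex hull pts x I face_of convex hull pts x UNIV"
    and sat: "\<And>k. k \<notin> I \<Longrightarrow> x $ k \<notin> convex hull pts x I"
  obtains w where "supports x I w"
proof -
  let ?F = "convex hull pts x I" and ?P = "convex hull pts x UNIV"
  have "polyhedron ?P" by (intro polyhedron_convex_hull) simp
  then have "?F exposed_face_of ?P" using face by (simp add: exposed_face_of_polyhedron)
  then obtain a b where ab: "?P \<subseteq> {y. a \<bullet> y \<le> b}" "?F = ?P \<inter> {y. a \<bullet> y = b}"
    unfolding exposed_face_of_def by blast
  have row: "x $ k \<in> ?P" for k by (intro hull_inc) auto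
  have "a \<bullet> x $ i = b" if "i \<in> I" for i
    using ab(2) that hull_inc[of "x $ i" "pts x I" convex] by auto
  moreover have "a \<bullet> x $ k < b" if "k \<notin> I" for k
    using ab row[of k] sat[OF that] by force
  ultimately have "supports x I a" by (simp add: supports_def level_def inner_commute[of _ a])
  then show ?thesis by (rule that)
qed

lemma face_if_supports:
  fixes x :: "real ^ 'd ^ 'n::finite"
  assumes w: "supports x I w" and I: "I \<noteq> {}"
  shows "convex hull pts x I face_of convex hull pts x UNIV"
proof -
  let ?F = "convex hull pts x I" and ?P = "convex hull pts x UNIV"
  obtain i where i: "i \<in> I" using I by blast
  define c where "c = w \<bullet> x $ i"
  have eq: "w \<bullet> x $ k = c" if "k \<in> I" for k
    using w levelD[of w x I k i] that i by (simp add: supports_def c_def inner_commute[of w])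
  have lt: "w \<bullet> x $ k < c" if "k \<notin> I" for k
    using w i that by (simp add: supports_def c_def inner_commute[of w])
  have le: "w \<bullet> x $ k \<le> c" for k using eq[of k] lt[of k] by (cases "k \<in> I") auto
  have "?P \<subseteq> {y. w \<bullet> y \<le> c}"
    using le by (intro hull_minimal convex_halfspace_le) auto
  then have face: "?P \<inter> {y. w \<bullet> y = c} face_of ?P"
    by (intro face_of_Int_supporting_hyperplane_le) (auto simp: convex_convex_hull)
  then obtain S where S: "S \<subseteq> pts x UNIV" "?P \<inter> {y. w \<bullet> y = c} = convex hull S"
    using face_of_convex_hull_subset[of "pts x UNIV"] by (metis finite_imp_compact finite_imageI finite)
  have "S \<subseteq> pts x I"
  proof
    fix s assume s: "s \<in> S"
    then have "w \<bullet> s = c" using S(2) hull_inc[OF s, of convex] by auto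
    then show "s \<in> pts x I" using s S(1) lt by fastforce
  qed
  then have "convex hull S \<subseteq> ?F" by (rule hull_mono)
  moreover have "?F \<subseteq> ?P \<inter> {y. w \<bullet> y = c}"
    using eq by (intro hull_minimal convex_Int convex_convex_hull convex_hyperplane) (auto intro: hull_inc)
  ultimately have "?F = convex hull S" using S(2) by blast
  then show ?thesis using face S(2) by simp
qed

text \<open>
  Generators of the direction space of the affine hull of the points in \<open>I\<close>, as a list for use with
  \<open>resid\<close>.
\<close>

definition edges :: "'n set \<Rightarrow> real ^ 'd ^ 'n::finite \<Rightarrow> (real ^ 'd) list" where
  "edges I x = map (\<lambda>i. x $ i - x $ (SOME i. i \<in> I)) (SOME l. set l = I)"

lemma set_edges: "set (edges I x) = (\<lambda>i. x $ i - x $ (SOME i. i \<in> I)) ` I"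
proof -
  have "set (SOME l. set l = I) = I" by (rule someI_ex) (simp add: finite_list)
  then show ?thesis by (simp add: edges_def)
qed

lemma diff_in_span_edges:
  assumes "i \<in> I" "k \<in> I"
  shows "x $ i - x $ k \<in> span (set (edges I x))"
proof -
  let ?b = "SOME i. i \<in> I"
  have "(x $ i - x $ ?b) - (x $ k - x $ ?b) \<in> span (set (edges I x))"
    using assms by (intro span_diff span_base) (auto simp: set_edges)
  then show ?thesis by simp
qed

lemma orth_proj_on_level: 
  assumes "I \<noteq> {}"
  shows "orth_proj_on (level x I) (resid (edges I x))"
  unfolding orth_proj_on_def
proof (intro conjI allI ballI subspace_level)
  fix z
  have "x $ i \<bullet> resid (edges I x) z = x $ k \<bullet> resid (edges I x) z" if "i \<in> I" "k \<in> I" for i k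
    using resid_orth[OF diff_in_span_edges[OF that, of x], of z]
    by (simp add: inner_diff_right inner_commute)
  then show "resid (edges I x) z \<in> level x I"
    unfolding level_def by blast
  fix y assume y: "y \<in> level x I"
  have b: "(SOME i. i \<in> I) \<in> I" using assms by (simp add: some_in_eq)
  have orth: "y \<bullet> u = 0" if "u \<in> span (set (edges I x))" for u
    using that
  proof (induction rule: span_induct_alt)
    case (step c u v)
    have "y \<bullet> u = 0"
      using step(1) levelD[OF y _ b]
      by (auto simp: set_edges inner_diff_left inner_commute[of y])
    then show ?case using step by (simp add: inner_add_right)
  qed simp
  show "resid (edges I x) z \<bullet> y = z \<bullet> y"
    using orth[OF resid_diff_in_span[of z "edges I x"]] by (simp add: inner_diff_right inner_commute)
qed

text \<open>
  Turns membership in an affine hull into a Borel condition on the points.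
\<close>

lemma affine_hull_iff_resid:
  assumes "I \<noteq> {}"
  shows "y \<in> affine hull pts x I \<longleftrightarrow> resid (edges I x) (y - x $ (SOME i. i \<in> I)) = 0"
proof -
  let ?b = "SOME i. i \<in> I"
  have b: "?b \<in> I" using assms by (simp add: some_in_eq)
  have "span ((+) (- (x $ ?b)) ` (pts x I - {x $ ?b})) = span (set (edges I x))"
  proof (rule span_eq[THEN iffD2], intro conjI)
    show "(+) (- (x $ ?b)) ` (pts x I - {x $ ?b}) \<subseteq> span (set (edges I x))"
      by (auto simp: set_edges intro!: span_base)
    show "set (edges I x) \<subseteq> span ((+) (- (x $ ?b)) ` (pts x I - {x $ ?b}))"
    proof
      fix u assume "u \<in> set (edges I x)"
      then obtain i where i: "i \<in> I" "u = x $ i - x $ ?b" by (auto simp: set_edges)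
      show "u \<in> span ((+) (- (x $ ?b)) ` (pts x I - {x $ ?b}))"
      proof (cases "u = 0")
        case False
        then have "u \<in> (+) (- (x $ ?b)) ` (pts x I - {x $ ?b})"
          using i by (auto intro!: image_eqI[of _ _ "x $ i"])
        then show ?thesis by (rule span_base)
      qed (simp add: span_zero)
    qed
  qed
  then have "affine hull pts x I = (+) (x $ ?b) ` span (set (edges I x))"
    using affine_hull_span2[of "x $ ?b" "pts x I"] b by auto
  then show ?thesis unfolding resid_eq_0_iff
    by (auto simp: image_iff algebra_simps intro!: bexI[of _ "y - x $ ?b"])
qed

text \<open>
  Degenerate configurations may contain repeated points, or points in the relative interior of a face.
  A face is therefore represented by the set of all indices whose points lie in it. This set is closed
  under passing to points of the affine hull, which makes the representation unique.
\<close>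

definition flats :: "nat \<Rightarrow> real ^ 'd ^ 'n::finite \<Rightarrow> 'n set set" where
  "flats j x = {I. aff_dim (pts x I) = int j \<and> (\<forall>k\<in>-I. x $ k \<notin> affine hull pts x I)}"

lemma flats_nonempty: "I \<in> flats j x \<Longrightarrow> I \<noteq> {}"
  by (auto simp: flats_def)

lemma bij_betw_flats_faces:
  fixes x :: "real ^ 'd ^ 'n::finite"
  shows "bij_betw (\<lambda>I. convex hull pts x I)
     {I \<in> flats j x. convex hull pts x I face_of convex hull pts x UNIV} (faces j (convex hull pts x UNIV))"
    (is "bij_betw ?h ?B (faces j ?P)")
proof (rule bij_betw_byWitness[where f' = "\<lambda>F. {i. x $ i \<in> F}"])
  show "\<forall>I\<in>?B. {i. x $ i \<in> ?h I} = I"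
  proof
    fix I assume "I \<in> ?B"
    then have "\<And>k. k \<notin> I \<Longrightarrow> x $ k \<notin> ?h I"
      using convex_hull_subset_affine_hull by (fastforce simp: flats_def)
    then show "{i. x $ i \<in> ?h I} = I" by (auto intro: hull_inc)
  qed
  have key: "?h {i. x $ i \<in> F} = F" if F: "F face_of ?P" for F
  proof -
    obtain S where S: "S \<subseteq> pts x UNIV" "F = convex hull S"
      using face_of_convex_hull_subset[OF _ F] by (metis finite_imp_compact finite_imageI finite)
    have "S \<subseteq> pts x {i. x $ i \<in> F}" using S by (auto intro: hull_inc)
    then have "F \<subseteq> ?h {i. x $ i \<in> F}" unfolding S(2) by (rule hull_mono)
    moreover have "?h {i. x $ i \<in> F} \<subseteq> F"
      using F by (intro hull_minimal) (auto simp: face_of_def)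
    ultimately show ?thesis by blast
  qed
  then show "\<forall>F\<in>faces j ?P. ?h {i. x $ i \<in> F} = F" by (simp add: faces_def)
  show "?h ` ?B \<subseteq> faces j ?P" by (auto simp: faces_def flats_def aff_dim_convex_hull)
  show "(\<lambda>F. {i. x $ i \<in> F}) ` faces j ?P \<subseteq> ?B"
  proof clarify
    fix F assume F: "F \<in> faces j ?P"
    then have face: "F face_of ?P" by (simp add: faces_def)
    have h: "?h {i. x $ i \<in> F} = F" by (rule key[OF face])
    have aff: "affine hull pts x {i. x $ i \<in> F} = affine hull F"
      using affine_hull_convex_hull[of "pts x {i. x $ i \<in> F}"] h by simp
    have "aff_dim (pts x {i. x $ i \<in> F}) = int j"
      using F h aff_dim_convex_hull[of "pts x {i. x $ i \<in> F}"] by (simp add: faces_def)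
    moreover have "x $ k \<notin> affine hull F" if "x $ k \<notin> F" for k
    proof -
      have "F = affine hull F \<inter> ?P" by (rule face_of_imp_eq_affine_Int[OF convex_convex_hull face])
      moreover have "x $ k \<in> ?P" by (intro hull_inc) auto
      ultimately show ?thesis using that by blast
    qed
    ultimately show "{i. x $ i \<in> F} \<in> flats j x \<and> ?h {i. x $ i \<in> F} face_of ?P"
      using face by (simp add: flats_def aff h)
  qed
qed

text \<open>
  If the points in \<open>I\<close> span no face, no functional is strictly maximal on \<open>I\<close>. The normal cone
  is then covered by finitely many hyperplanes of the level space, one for each \<open>k\<close> outside \<open>I\<close>;
  they are proper because \<open>x $ k\<close> is not in the affine hull of the points in \<open>I\<close>.
\<close>

lemma ncone_null:
  fixes x :: "real ^ 'd ^ 'n::finite"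
  assumes I: "I \<in> flats j x" and nf: "\<not> convex hull pts x I face_of convex hull pts x UNIV"
  shows "measure gauss {z. resid (edges I x) z \<in> ncone x I} = 0"
proof -
  have ne: "I \<noteq> {}" using I by (rule flats_nonempty)
  let ?b = "SOME i. i \<in> I"
  have b: "?b \<in> I" using ne by (simp add: some_in_eq)
  note p = orth_proj_on_level[OF ne, of x]
  have "AE z in gauss. resid (edges I x) z \<bullet> (x $ k - x $ ?b) \<noteq> 0" if "k \<in> -I" for k
    using that I affine_hull_iff_resid[OF ne, of "x $ k" x]
    by (intro AE_gauss_orth_proj_inner[OF p]) (auto simp: flats_def)
  then have "AE z in gauss. \<forall>k\<in>-I. resid (edges I x) z \<bullet> (x $ k - x $ ?b) \<noteq> 0"
    by (intro AE_finite_allI) auto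
  then have "AE z in gauss. z \<notin> {z. resid (edges I x) z \<in> ncone x I}"
  proof eventually_elim
    case (elim z)
    let ?w = "resid (edges I x) z"
    show ?case
    proof
      assume "z \<in> {z. resid (edges I x) z \<in> ncone x I}"
      then have w: "resid (edges I x) z \<in> ncone x I" by simp
      have "supports x I ?w"
        unfolding supports_def
      proof (intro conjI ballI)
        show lev: "?w \<in> level x I" using w ncone_subset_level by blast
        fix i k assume ik: "i \<in> I" "k \<in> -I"
        have "x $ i \<bullet> ?w = x $ ?b \<bullet> ?w" by (rule levelD[OF lev ik(1) b])
        moreover have "x $ k \<bullet> ?w \<noteq> x $ ?b \<bullet> ?w"
          using elim ik(2) by (simp add: inner_diff_right inner_commute[of "x $ _"])
        moreover have "x $ k \<bullet> ?w \<le> x $ i \<bullet> ?w" using w ik(1) by (simp add: mem_ncone)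
        ultimately show "x $ k \<bullet> ?w < x $ i \<bullet> ?w" by simp
      qed
      then show False using face_if_supports[OF _ ne] nf by blast
    qed
  qed
  moreover have "{z. resid (edges I x) z \<in> ncone x I} \<in> sets borel"
    using measurable_sets[OF borel_measurable_linear[OF orth_proj_on_linear[OF p]], of "ncone x I"]
    by (simp add: closed_ncone vimage_def)
  ultimately show ?thesis by (simp add: gauss.prob_eq_0)
qed

text \<open>
  This holds for every configuration, degenerate or not. It trades the faces, which vary with
  \<open>x\<close>, for subsets of a fixed index set, so that measurability in \<open>x\<close> can be checked term by
  term. Index sets that give no face may be included, as they contribute 0.
\<close>

lemma angle_sum_eq:
  fixes x :: "real ^ 'd ^ 'n::finite"
  shows "(\<Sum>F\<in>faces j (convex hull pts x UNIV). solid_angle (normal_cone F (convex hull pts x UNIV)))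
    = (\<Sum>I\<in>flats j x. measure gauss {z. resid (edges I x) z \<in> ncone x I})"
proof -
  let ?h = "\<lambda>I. convex hull pts x I" and ?P = "convex hull pts x UNIV"
  let ?B = "{I \<in> flats j x. ?h I face_of ?P}"
  have "(\<Sum>F\<in>faces j ?P. solid_angle (normal_cone F ?P)) = (\<Sum>I\<in>?B. solid_angle (normal_cone (?h I) ?P))"
    by (rule sum.reindex_bij_betw[OF bij_betw_flats_faces, symmetric])
  also have "\<dots> = (\<Sum>I\<in>?B. measure gauss {z. resid (edges I x) z \<in> ncone x I})"
  proof (rule sum.cong[OF refl])
    fix I assume I: "I \<in> ?B"
    then have ne: "I \<noteq> {}" using flats_nonempty by blast
    have "\<And>k. k \<notin> I \<Longrightarrow> x $ k \<notin> ?h I"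
      using I convex_hull_subset_affine_hull by (fastforce simp: flats_def)
    then obtain w where "supports x I w" using I exists_supports_if_face[of x I] by blast
    then show "solid_angle (normal_cone (?h I) ?P) = measure gauss {z. resid (edges I x) z \<in> ncone x I}"
      unfolding normal_cone_convex_hull[OF ne]
      using zero_in_ncone[of x I]
      by (intro solid_angle_eq_gauss[OF orth_proj_on_level[OF ne]] span_ncone closed_ncone cone_ncone) auto
  qed
  also have "\<dots> = (\<Sum>I\<in>flats j x. measure gauss {z. resid (edges I x) z \<in> ncone x I})"
    by (intro sum.mono_neutral_left) (auto intro: ncone_null)
  finally show ?thesis .
qed

section \<open>The expected external angle at a fixed index set\<close>

lemma borel_measurable_vec_nth [measurable]:
  fixes f :: "'b \<Rightarrow> 'a::euclidean_space ^ 'n"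
  assumes [measurable]: "f \<in> borel_measurable N"
  shows "(\<lambda>x. f x $ i) \<in> borel_measurable N"
  by (rule measurable_compose[OF assms])
    (simp add: borel_measurable_continuous_onI linear_continuous_on bounded_linear_vec_nth)

text \<open>
  The components of a Gaussian vector in two complementary orthogonal subspaces may be drawn from two
  independent copies: \<open>(y, x) \<mapsto> p x + (y - p y)\<close> is a coisometry.
\<close>

lemma nn_integral_gauss_resample:
  fixes f :: "'a::euclidean_space \<Rightarrow> ennreal"
  assumes p: "orth_proj_on L p" and f[measurable]: "f \<in> borel_measurable borel"
  shows "(\<integral>\<^sup>+x. f x \<partial>gauss) = (\<integral>\<^sup>+y. \<integral>\<^sup>+x. f (p x + (y - p y)) \<partial>gauss \<partial>gauss)"
proof -
  have lin: "linear p" by (rule orth_proj_on_linear[OF p])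
  have pp: "p (p x) = p x" for x by (rule orth_proj_on_self[OF p orth_proj_onD(2)[OF p]])
  define T where "T = (\<lambda>(y, x). p x + (y - p y))"
  have linT: "linear T"
    by (rule linearI) (auto simp: T_def linear_add[OF lin] linear_cmul[OF lin] algebra_simps)
  note [measurable] = borel_measurable_linear[OF linT] borel_measurable_linear[OF lin]
  have "distr gauss borel T = gauss"
  proof (rule distr_gauss_coisometry[OF linT])
    show "T z \<bullet> v = z \<bullet> (v - p v, p v)" for z v
      by (cases z) (simp add: T_def inner_add_left inner_diff_left inner_diff_right orth_proj_on_inner[OF p])
    show "T (v - p v, p v) = v" for v
      by (simp add: T_def linear_diff[OF lin] pp)
  qed
  then have "(\<integral>\<^sup>+x. f x \<partial>gauss) = (\<integral>\<^sup>+x. f x \<partial>distr gauss borel T)" by simp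
  also have "\<dots> = (\<integral>\<^sup>+z. f (T z) \<partial>(gauss \<Otimes>\<^sub>M gauss))"
    unfolding gauss_pair by (subst nn_integral_distr) auto
  also have "\<dots> = (\<integral>\<^sup>+y. \<integral>\<^sup>+x. f (T (y, x)) \<partial>gauss \<partial>gauss)"
    by (subst gauss.nn_integral_fst[symmetric]) (simp_all add: T_def case_prod_beta)
  finally show ?thesis by (simp add: T_def)
qed

text \<open>
  Replaces each row with index in \<open>I\<close> by their mean. This is the orthogonal projection onto the
  matrices whose rows agree on \<open>I\<close>, and with \<open>'a = real\<close> it is the projection onto the linear hull of
  the normal cone of a face of the regular simplex.
\<close>

definition avg :: "'n::finite set \<Rightarrow> 'a::euclidean_space ^ 'n \<Rightarrow> 'a ^ 'n" where
  "avg I x = (\<chi> i. if i \<in> I then (1 / card I) *\<^sub>R (\<Sum>l\<in>I. x $ l) else x $ i)"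

lemma orth_proj_on_avg:
  fixes I :: "'b::finite set"
  shows "orth_proj_on {x :: 'a::euclidean_space ^ 'b. \<forall>i\<in>I. \<forall>k\<in>I. x $ i = x $ k} (avg I)"
    (is "orth_proj_on ?L _")
  unfolding orth_proj_on_def
proof (intro conjI allI ballI)
  show "subspace ?L"
  proof (rule subspaceI)
    show "u + v \<in> ?L" if uv: "u \<in> ?L" "v \<in> ?L" for u v
    proof -
      have "(u + v) $ i = (u + v) $ k" if "i \<in> I" "k \<in> I" for i k
      proof -
        have "u $ i = u $ k" "v $ i = v $ k" using uv that by blast+
        then show ?thesis by simp
      qed
      then show ?thesis by blast
    qed
    show "c *\<^sub>R u \<in> ?L" if u: "u \<in> ?L" for c u
    proof -
      have "(c *\<^sub>R u) $ i = (c *\<^sub>R u) $ k" if "i \<in> I" "k \<in> I" for i k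
      proof -
        have "u $ i = u $ k" using u that by blast
        then show ?thesis by simp
      qed
      then show ?thesis by blast
    qed
  qed simp
  show "avg I z \<in> ?L" for z
    by (simp add: avg_def)
  show "avg I z \<bullet> y = z \<bullet> y" if yL: "y \<in> ?L" for z y
  proof (cases "I = {}")
    case False
    then obtain b where b: "b \<in> I" by blast
    have y: "y $ i = y $ b" if "i \<in> I" for i using that b yL by blast
    have split: "u \<bullet> y = (\<Sum>i\<in>I. u $ i) \<bullet> y $ b + (\<Sum>i\<in>-I. u $ i \<bullet> y $ i)" for u
    proof -
      have "u \<bullet> y = (\<Sum>i\<in>I. u $ i \<bullet> y $ i) + (\<Sum>i\<in>-I. u $ i \<bullet> y $ i)"
        unfolding inner_vec_def by (subst sum.union_disjoint[symmetric]) auto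
      also have "(\<Sum>i\<in>I. u $ i \<bullet> y $ i) = (\<Sum>i\<in>I. u $ i) \<bullet> y $ b"
        by (simp add: inner_sum_left y)
      finally show ?thesis .
    qed
    have "(\<Sum>i\<in>I. avg I z $ i) = (\<Sum>i\<in>I. z $ i)"
      using False by (simp add: avg_def sum_constant_scaleR)
    moreover have "(\<Sum>i\<in>-I. avg I z $ i \<bullet> y $ i) = (\<Sum>i\<in>-I. z $ i \<bullet> y $ i)"
      by (simp add: avg_def)
    ultimately show ?thesis by (simp only: split)
  next
    case True
    then have "avg I z = z" by (simp add: avg_def vec_eq_iff)
    then show ?thesis by simp
  qed
qed

lemma avg_matrix_vector:
  fixes x :: "real ^ 'd ^ 'n::finite"
  shows "avg I x *v w = avg I (x *v w)"
  by (simp add: vec_eq_iff avg_def matrix_vector_mul_component inner_sum_left)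

lemma distr_gauss_matrix_vector:
  fixes u :: "real ^ 'd"
  assumes "norm u = 1"
  shows "distr gauss borel (\<lambda>x :: real ^ 'd ^ 'n::finite. x *v u) = gauss"
proof (rule distr_gauss_coisometry)
  have uu: "u \<bullet> u = 1" using assms by (simp add: norm_eq_1)
  show "linear (\<lambda>x :: real ^ 'd ^ 'n. x *v u)"
    by (rule linearI) (simp_all add: vec_eq_iff matrix_vector_mul_component inner_add_left)
  show "(x *v u) \<bullet> g = x \<bullet> (\<chi> i. g $ i *\<^sub>R u)" for x :: "real ^ 'd ^ 'n" and g
    by (simp add: inner_vec_def[of "x *v u"] inner_vec_def[of x] matrix_vector_mul_component mult.commute)
  show "(\<chi> i. g $ i *\<^sub>R u) *v u = g" for g :: "real ^ 'n"
    by (simp add: vec_eq_iff matrix_vector_mul_component uu)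
qed

lemma max_cone_scale:
  assumes "c > 0"
  shows "c *\<^sub>R v \<in> max_cone I \<longleftrightarrow> v \<in> max_cone I"
  using assms by (simp add: max_cone_def)

lemma borel_max_cone [measurable]: "max_cone I \<in> sets borel"
proof -
  have "max_cone I = (\<Inter>i\<in>I. \<Inter>k. {v. v $ k \<le> v $ i})" by (auto simp: max_cone_def)
  then have "closed (max_cone I)" by (auto intro!: closed_INT closed_Collect_le continuous_intros)
  then show ?thesis by simp
qed

lemma borel_avg [measurable]: "avg I \<in> borel_measurable borel"
  by (intro borel_measurable_linear orth_proj_on_linear[OF orth_proj_on_avg])

text \<open>
  For a unit vector \<open>w\<close> the product of a Gaussian matrix with \<open>w\<close> is a standard Gaussian vector, and
  rescaling \<open>w\<close> does not affect membership in a cone.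
\<close>

lemma emeasure_gauss_avg_matrix_vector:
  fixes w :: "real ^ 'd"
  assumes w: "w \<noteq> 0"
  shows "emeasure gauss {x :: real ^ 'd ^ 'n::finite. avg I x *v w \<in> max_cone I}
       = emeasure gauss {v :: real ^ 'n. avg I v \<in> max_cone I}"
proof -
  define u where "u = (1 / norm w) *\<^sub>R w"
  have u: "norm u = 1" using w by (simp add: u_def)
  have w_u: "w = norm w *\<^sub>R u" using w by (simp add: u_def)
  have lin: "linear (avg I :: real ^ 'n \<Rightarrow> real ^ 'n)" by (rule orth_proj_on_linear[OF orth_proj_on_avg])
  have eq: "avg I x *v w \<in> max_cone I \<longleftrightarrow> avg I (x *v u) \<in> max_cone I" for x :: "real ^ 'd ^ 'n"
  proof -
    have "x *v w = norm w *\<^sub>R (x *v u)"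
      by (subst w_u) (simp add: vec_eq_iff matrix_vector_mul_component)
    then have "avg I x *v w = norm w *\<^sub>R avg I (x *v u)"
      by (simp add: avg_matrix_vector linear_cmul[OF lin])
    then show ?thesis using w by (simp add: max_cone_scale)
  qed
  have m[measurable]: "(\<lambda>x :: real ^ 'd ^ 'n. x *v u) \<in> borel_measurable borel"
    by (intro borel_measurable_linear linearI) (simp_all add: vec_eq_iff matrix_vector_mul_component inner_add_left)
  have "emeasure gauss {v :: real ^ 'n. avg I v \<in> max_cone I}
      = emeasure (distr gauss borel (\<lambda>x :: real ^ 'd ^ 'n. x *v u)) {v. avg I v \<in> max_cone I}"
    by (simp add: distr_gauss_matrix_vector[OF u])
  also have "\<dots> = emeasure gauss {x :: real ^ 'd ^ 'n. avg I x *v w \<in> max_cone I}"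
    by (subst emeasure_distr) (auto simp: eq vimage_def)
  finally show ?thesis by simp
qed

lemma edges_cong:
  assumes "\<And>i k. i \<in> I \<Longrightarrow> k \<in> I \<Longrightarrow> x $ i - x $ k = y $ i - y $ k"
  shows "edges I x = edges I y"
proof -
  have "set (SOME l. set l = I) = I" by (rule someI_ex) (simp add: finite_list)
  moreover have "(SOME i. i \<in> I) \<in> I" if "i \<in> I" for i
    using that by (rule someI)
  ultimately show ?thesis unfolding edges_def by (intro map_cong refl assms) auto
qed

lemma measurable_resid_edges [measurable]:
  assumes "f \<in> borel_measurable N" "g \<in> borel_measurable N"
  shows "(\<lambda>y. resid (edges I (f y)) (g y)) \<in> borel_measurable N"
  unfolding edges_def
  by (intro measurable_resid borel_measurable_diff borel_measurable_vec_nth assms)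

lemma measurable_matrix_vector [measurable]:
  assumes [measurable]: "f \<in> borel_measurable N" "g \<in> borel_measurable N"
  shows "(\<lambda>y. f y *v g y :: real ^ 'n) \<in> borel_measurable N"
proof -
  have "(\<lambda>y. (f y *v g y) \<bullet> b) \<in> borel_measurable N" if "b \<in> Basis" for b :: "real ^ 'n"
  proof -
    from that obtain i where "b = axis i 1" by (auto simp: Basis_vec_def)
    then show ?thesis by (simp add: inner_axis matrix_vector_mul_component)
  qed
  then show ?thesis by (intro iffD2[OF borel_measurable_euclidean_space]) blast
qed

lemma exists_not_in_span_edges:
  fixes x :: "real ^ 'd ^ 'n::finite"
  assumes I: "I \<noteq> {}" and card: "card I \<le> CARD('d)"
  obtains a where "resid (edges I x) a \<noteq> 0"
proof -
  let ?b = "SOME i. i \<in> I"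
  have b: "?b \<in> I" using I by (simp add: some_in_eq)
  have "span (set (edges I x)) \<subseteq> span ((\<lambda>i. x $ i - x $ ?b) ` (I - {?b}))"
  proof (intro span_minimal subspace_span subsetI)
    fix u assume "u \<in> set (edges I x)"
    then obtain i where "i \<in> I" "u = x $ i - x $ ?b" by (auto simp: set_edges)
    then show "u \<in> span ((\<lambda>i. x $ i - x $ ?b) ` (I - {?b}))"
      by (cases "i = ?b") (auto simp: span_zero intro: span_base)
  qed
  moreover have "dim (span ((\<lambda>i. x $ i - x $ ?b) ` (I - {?b}))) < CARD('d)"
  proof -
    have "dim (span ((\<lambda>i. x $ i - x $ ?b) ` (I - {?b}))) \<le> card ((\<lambda>i. x $ i - x $ ?b) ` (I - {?b}))"
      unfolding dim_span by (rule dim_le_card') simp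
    also have "\<dots> \<le> card (I - {?b})" by (rule card_image_le) simp
    also have "\<dots> < card I" using b by (intro card_Diff1_less) auto
    finally show ?thesis using card by simp
  qed
  ultimately have "span (set (edges I x)) \<noteq> UNIV"
    using dim_subset[of "span (set (edges I x))"] by (metis dim_UNIV DIM_cart DIM_real mult_1_right not_le)
  then show ?thesis using that resid_eq_0_iff by blast
qed

text \<open>
  Write \<open>w\<close> for the projection of a Gaussian vector to the level space of the points in \<open>I\<close>. It
  depends on these points only through their differences, while the normal cone condition
  concerns the numbers \<open>x $ k \<bullet> w\<close>, for which, as \<open>w\<close> is orthogonal to those differences, only the
  averaged matrix matters. Differences and averaged matrix are independent, so \<open>w\<close> may be fixed, and the
  averaged matrix times \<open>w\<close> has, up to scaling, a law independent of \<open>w\<close>. The bound on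
  \<open>card I\<close> guarantees that \<open>w\<close> is almost surely nonzero.
\<close>

lemma nn_integral_angle:
  assumes I: "I \<noteq> {}" and card: "card I \<le> CARD('d)"
  shows "(\<integral>\<^sup>+x. emeasure gauss {z. resid (edges I x) z \<in> ncone x I} \<partial>(gauss :: (real ^ 'd ^ 'n::finite) measure))
       = emeasure gauss {v :: real ^ 'n. avg I v \<in> max_cone I}"
proof -
  let ?Q = "emeasure gauss {v :: real ^ 'n. avg I v \<in> max_cone I}"
  let ?r = "\<lambda>x z. resid (edges I x) z"
  have em: "emeasure gauss {z. ?r x z \<in> ncone x I} = (\<integral>\<^sup>+z. indicator (max_cone I) (x *v ?r x z) \<partial>gauss)"
    for x :: "real ^ 'd ^ 'n"
  proof -
    have [measurable]: "{z. x *v ?r x z \<in> max_cone I} \<in> sets borel" by measurable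
    have "emeasure gauss {z. ?r x z \<in> ncone x I} = (\<integral>\<^sup>+z. indicator {z. x *v ?r x z \<in> max_cone I} z \<partial>gauss)"
      by (simp add: ncone_def)
    also have "\<dots> = (\<integral>\<^sup>+z. indicator (max_cone I) (x *v ?r x z) \<partial>gauss)"
      by (intro nn_integral_cong) (simp add: indicator_def)
    finally show ?thesis .
  qed
  have fib: "x *v w = avg I v *v w" if x: "x = avg I v + (y - avg I y)" and w: "w \<in> level y I"
    for x y v :: "real ^ 'd ^ 'n" and w
  proof -
    \<comment> \<open>The rows of \<open>y - avg I y\<close> are combinations of differences of rows in \<open>I\<close>.\<close>
    have "(y - avg I y) $ i \<bullet> w = 0" for i
    proof (cases "i \<in> I")
      case True
      have "(\<Sum>l\<in>I. y $ l) \<bullet> w = card I * (y $ i \<bullet> w)"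
        using levelD[OF w _ True] by (simp add: inner_sum_left)
      then show ?thesis using True I by (simp add: avg_def inner_diff_left)
    qed (simp add: avg_def)
    then show ?thesis by (simp add: vec_eq_iff matrix_vector_mul_component x inner_add_left)
  qed
  have "(\<integral>\<^sup>+x. emeasure gauss {z. ?r x z \<in> ncone x I} \<partial>(gauss :: (real ^ 'd ^ 'n) measure))
      = (\<integral>\<^sup>+y. \<integral>\<^sup>+v. (\<integral>\<^sup>+z. indicator (max_cone I) ((avg I v + (y - avg I y)) *v ?r (avg I v + (y - avg I y)) z) \<partial>gauss)
           \<partial>(gauss :: (real ^ 'd ^ 'n) measure) \<partial>(gauss :: (real ^ 'd ^ 'n) measure))"
    unfolding em by (rule nn_integral_gauss_resample[OF orth_proj_on_avg]) measurable
  also have "\<dots> = (\<integral>\<^sup>+y. \<integral>\<^sup>+v. (\<integral>\<^sup>+z. indicator (max_cone I) (avg I v *v ?r y z) \<partial>gauss)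
           \<partial>(gauss :: (real ^ 'd ^ 'n) measure) \<partial>(gauss :: (real ^ 'd ^ 'n) measure))"
  proof (intro nn_integral_cong)
    fix y v :: "real ^ 'd ^ 'n" and z :: "real ^ 'd"
    let ?x = "avg I v + (y - avg I y)"
    have "edges I ?x = edges I y" by (rule edges_cong) (simp add: avg_def)
    then have "?x *v ?r ?x z = avg I v *v ?r y z"
      using fib[OF refl orth_proj_onD(2)[OF orth_proj_on_level[OF I]], of v y z] by simp
    then show "indicator (max_cone I) (?x *v ?r ?x z) = (indicator (max_cone I) (avg I v *v ?r y z) :: ennreal)"
      by simp
  qed
  also have "\<dots> = (\<integral>\<^sup>+y. ?Q \<partial>(gauss :: (real ^ 'd ^ 'n) measure))"
  proof (intro nn_integral_cong)
    fix y :: "real ^ 'd ^ 'n"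
    interpret pair_sigma_finite "gauss :: (real ^ 'd) measure" "gauss :: (real ^ 'd ^ 'n) measure" ..
    have "(\<integral>\<^sup>+v. (\<integral>\<^sup>+z. indicator (max_cone I) (avg I v *v ?r y z) \<partial>gauss) \<partial>(gauss :: (real ^ 'd ^ 'n) measure))
        = (\<integral>\<^sup>+z. (\<integral>\<^sup>+v. indicator (max_cone I) (avg I v *v ?r y z) \<partial>(gauss :: (real ^ 'd ^ 'n) measure)) \<partial>gauss)"
      by (rule Fubini') measurable
    also have "\<dots> = (\<integral>\<^sup>+z. ?Q \<partial>(gauss :: (real ^ 'd) measure))"
    proof (rule nn_integral_cong_AE)
      obtain a where "?r y a \<noteq> 0" using exists_not_in_span_edges[OF I card] .
      then have "AE z in gauss. ?r y z \<bullet> a \<noteq> 0"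
        by (rule AE_gauss_orth_proj_inner[OF orth_proj_on_level[OF I]])
      then show "AE z in gauss. (\<integral>\<^sup>+v. indicator (max_cone I) (avg I v *v ?r y z) \<partial>(gauss :: (real ^ 'd ^ 'n) measure)) = ?Q"
      proof eventually_elim
        case (elim z)
        define w where "w = ?r y z"
        have "w \<noteq> 0" using elim by (auto simp: w_def)
        have [measurable]: "{v :: real ^ 'd ^ 'n. avg I v *v w \<in> max_cone I} \<in> sets borel" by measurable
        have "(\<integral>\<^sup>+v. indicator (max_cone I) (avg I v *v w) \<partial>(gauss :: (real ^ 'd ^ 'n) measure))
            = emeasure gauss {v :: real ^ 'd ^ 'n. avg I v *v w \<in> max_cone I}"
        proof -
          have "(\<integral>\<^sup>+v. indicator (max_cone I) (avg I v *v w) \<partial>(gauss :: (real ^ 'd ^ 'n) measure))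
              = (\<integral>\<^sup>+v. indicator {v. avg I v *v w \<in> max_cone I} v \<partial>(gauss :: (real ^ 'd ^ 'n) measure))"
            by (intro nn_integral_cong) (simp add: indicator_def)
          also have "\<dots> = emeasure gauss {v :: real ^ 'd ^ 'n. avg I v *v w \<in> max_cone I}"
            by (rule nn_integral_indicator) simp
          finally show ?thesis .
        qed
        then show ?case using emeasure_gauss_avg_matrix_vector[OF \<open>w \<noteq> 0\<close>, of I] by (simp add: w_def)
      qed
    qed
    finally show "(\<integral>\<^sup>+v. (\<integral>\<^sup>+z. indicator (max_cone I) (avg I v *v ?r y z) \<partial>gauss) \<partial>(gauss :: (real ^ 'd ^ 'n) measure)) = ?Q"
      by (simp add: emeasure_gauss_UNIV)
  qed
  finally show ?thesis by (simp add: emeasure_gauss_UNIV)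
qed

section \<open>Configurations in general position\<close>

definition general_position :: "real ^ 'd ^ 'n::finite \<Rightarrow> bool" where
  "general_position x \<longleftrightarrow>
     (\<forall>I i. I \<noteq> {} \<longrightarrow> i \<notin> I \<longrightarrow> card I \<le> CARD('d) \<longrightarrow> x $ i \<notin> affine hull pts x I)"

lemma measurable_in_affine_hull [measurable]:
  assumes [measurable]: "f \<in> borel_measurable N" "g \<in> borel_measurable N"
  shows "Measurable.pred N (\<lambda>y. g y \<in> affine hull pts (f y :: real ^ 'd ^ 'n::finite) I)"
proof (cases "I = {}")
  case False
  show ?thesis unfolding affine_hull_iff_resid[OF False] by measurable
qed simp

lemma aff_dim_pts_le: "aff_dim (pts (x :: real ^ 'd ^ 'n::finite) I) \<le> int (card I) - 1"
proof -
  have "aff_dim (pts x I) \<le> int (card (pts x I)) - 1" by (intro aff_dim_le_card) simp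
  also have "card (pts x I) \<le> card I" by (intro card_image_le) simp
  finally show ?thesis by simp
qed

text \<open>
  Resampling row \<open>i\<close> leaves the affine hull of the rows in \<open>I\<close> fixed. This hull lies in a
  hyperplane, which the new row almost surely avoids.
\<close>

lemma AE_general_position:
  "AE x in (gauss :: (real ^ 'd ^ 'n::finite) measure). general_position x"
proof -
  have *: "AE x in (gauss :: (real ^ 'd ^ 'n) measure). x $ i \<notin> affine hull pts x I"
    if I: "i \<notin> I" "card I \<le> CARD('d)" for i I
  proof -
    \<comment> \<open>The projection that keeps row \<open>i\<close> only.\<close>
    define p :: "real ^ 'd ^ 'n \<Rightarrow> real ^ 'd ^ 'n" where "p x = (\<chi> k. if k = i then x $ k else 0)" for x
    have p: "orth_proj_on {x. \<forall>k. k \<noteq> i \<longrightarrow> x $ k = 0} p"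
      unfolding orth_proj_on_def
    proof (intro conjI allI ballI)
      show "subspace {x :: real ^ 'd ^ 'n. \<forall>k. k \<noteq> i \<longrightarrow> x $ k = 0}"
        by (rule subspaceI) auto
      show "p z \<bullet> y = z \<bullet> y" if "y \<in> {x. \<forall>k. k \<noteq> i \<longrightarrow> x $ k = 0}" for z y
        unfolding inner_vec_def using that by (intro sum.cong) (auto simp: p_def)
    qed (simp add: p_def)
    have "emeasure gauss {x :: real ^ 'd ^ 'n. x $ i \<in> affine hull pts x I}
        = (\<integral>\<^sup>+x. indicator {x. x $ i \<in> affine hull pts x I} x \<partial>(gauss :: (real ^ 'd ^ 'n) measure))"
      by simp
    also have "\<dots> = (\<integral>\<^sup>+y. \<integral>\<^sup>+x. indicator {x. x $ i \<in> affine hull pts x I} (p x + (y - p y))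
        \<partial>(gauss :: (real ^ 'd ^ 'n) measure) \<partial>(gauss :: (real ^ 'd ^ 'n) measure))"
      by (rule nn_integral_gauss_resample[OF p]) measurable
    also have "\<dots> = (\<integral>\<^sup>+y. 0 \<partial>(gauss :: (real ^ 'd ^ 'n) measure))"
    proof (rule nn_integral_cong)
      fix y :: "real ^ 'd ^ 'n"
      have "aff_dim (pts y I) < int DIM(real ^ 'd)" using aff_dim_pts_le[of y I] I(2) by simp
      then obtain a b where ab: "a \<noteq> 0" "pts y I \<subseteq> {v. a \<bullet> v = b}"
        by (rule aff_lowdim_subset_hyperplane)
      have hull: "affine hull pts y I \<subseteq> {v. a \<bullet> v = b}"
        using ab(2) by (intro hull_minimal affine_hyperplane)
      have "AE x in (gauss :: (real ^ 'd ^ 'n) measure). axis i a \<bullet> x \<noteq> b"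
        using ab(1) by (intro AE_gauss_hyperplane) (simp add: axis_eq_0_iff)
      then have "AE x in (gauss :: (real ^ 'd ^ 'n) measure).
          indicator {x. x $ i \<in> affine hull pts x I} (p x + (y - p y)) = (0 :: ennreal)"
      proof eventually_elim
        case (elim x)
        define u where "u = p x + (y - p y)"
        have "pts u I = pts y I" using I(1) by (intro image_cong) (auto simp: p_def u_def)
        moreover have "u $ i = x $ i" by (simp add: p_def u_def)
        moreover have "a \<bullet> x $ i \<noteq> b" using elim by (simp add: inner_axis')
        ultimately have "u $ i \<notin> affine hull pts u I" using hull by auto
        then show ?case by (simp add: u_def[symmetric])
      qed
      then show "(\<integral>\<^sup>+x. indicator {x. x $ i \<in> affine hull pts x I} (p x + (y - p y))
        \<partial>(gauss :: (real ^ 'd ^ 'n) measure)) = 0"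
        by (subst nn_integral_cong_AE[where v="\<lambda>_. 0"]) auto
    qed
    finally have "emeasure gauss {x :: real ^ 'd ^ 'n. x $ i \<in> affine hull pts x I} = 0" by simp
    then show ?thesis by (intro AE_I[where N="{x :: real ^ 'd ^ 'n. x $ i \<in> affine hull pts x I}"]) auto
  qed
  show ?thesis unfolding general_position_def
    by (intro AE_all_countable[THEN iffD2] allI AE_finite_all[THEN iffD2]) (auto intro: *)
qed

lemma general_position_aff_dim:
  fixes x :: "real ^ 'd ^ 'n::finite"
  assumes x: "general_position x"
  shows "card I \<le> CARD('d) + 1 \<Longrightarrow> aff_dim (pts x I) = int (card I) - 1"
proof (induction I rule: infinite_finite_induct)
  case (insert i I)
  show ?case
  proof (cases "I = {}")
    case False
    have "x $ i \<notin> affine hull pts x I"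
      using x insert False unfolding general_position_def by simp
    then show ?thesis using insert by (simp add: aff_dim_insert)
  qed simp
qed auto

text \<open>
  Fewer than \<open>j + 1\<close> points span too little and more than \<open>j + 1\<close> points span too much, as
  \<open>j + 2\<close> points are still affinely independent.
\<close>

lemma general_position_flats:
  fixes x :: "real ^ 'd ^ 'n::finite"
  assumes x: "general_position x" and j: "j < CARD('d)"
  shows "flats j x = {I. card I = j + 1}"
proof (intro set_eqI iffI)
  fix I assume "I \<in> flats j x"
  then have I: "aff_dim (pts x I) = int j" by (simp add: flats_def)
  have "card I \<ge> j + 1" using I aff_dim_pts_le[of x I] by simp
  moreover have "\<not> card I \<ge> j + 2"
  proof
    assume "card I \<ge> j + 2"
    then obtain J where J: "J \<subseteq> I" "card J = j + 2" by (metis obtain_subset_with_card_n)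
    have "aff_dim (pts x J) = int j + 1" using general_position_aff_dim[OF x, of J] J j by simp
    moreover have "aff_dim (pts x J) \<le> aff_dim (pts x I)" using J by (intro aff_dim_subset) auto
    ultimately show False using I by simp
  qed
  ultimately show "I \<in> {I. card I = j + 1}" by simp
next
  fix I :: "'n set" assume I: "I \<in> {I. card I = j + 1}"
  then have "I \<noteq> {}" by auto
  then show "I \<in> flats j x"
    using I j x general_position_aff_dim[OF x, of I] by (auto simp: flats_def general_position_def)
qed

lemma measurable_aff_dim_pts:
  "(\<lambda>x :: real ^ 'd ^ 'n::finite. aff_dim (pts x I)) \<in> borel \<rightarrow>\<^sub>M count_space UNIV"
proof (induction I rule: infinite_finite_induct)
  case (insert i I)
  note [measurable] = insert.IH
  show ?case by (simp add: aff_dim_insert)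
qed auto

lemma measurable_flats [measurable]:
  "Measurable.pred borel (\<lambda>x :: real ^ 'd ^ 'n::finite. I \<in> flats j x)"
proof -
  note [measurable] = measurable_aff_dim_pts
  show ?thesis unfolding flats_def mem_Collect_eq by measurable
qed

section \<open>The expected angle sum\<close>

text \<open>
  This is the external angle of the regular simplex at the face with vertex set \<open>I\<close>; see
  \<open>solid_angle_simplex_normal_cone\<close> below.
\<close>

definition angle_prob :: "'n::finite set \<Rightarrow> real" where
  "angle_prob I = measure gauss {v :: real ^ 'n. avg I v \<in> max_cone I}"

lemma measurable_angle [measurable]:
  "(\<lambda>x :: real ^ 'd ^ 'n::finite. measure gauss {z. resid (edges I x) z \<in> ncone x I}) \<in> borel_measurable borel"
proof -
  let ?H = "{p :: (real ^ 'd ^ 'n) \<times> (real ^ 'd). fst p *v resid (edges I (fst p)) (snd p) \<in> max_cone I}"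
  have "(\<lambda>p :: (real ^ 'd ^ 'n) \<times> (real ^ 'd). fst p *v resid (edges I (fst p)) (snd p))
      \<in> borel_measurable (borel \<Otimes>\<^sub>M borel)" by measurable
  from measurable_sets[OF this borel_max_cone[of I]]
  have "?H \<in> sets (borel \<Otimes>\<^sub>M borel)" by (simp add: space_pair_measure vimage_def)
  then have "?H \<in> sets (borel \<Otimes>\<^sub>M gauss)" by (simp cong: sets_pair_measure_cong)
  then have [measurable]: "(\<lambda>x. emeasure gauss (Pair x -` ?H)) \<in> borel_measurable borel"
    by (rule gauss.measurable_emeasure_Pair)
  have "{z. resid (edges I x) z \<in> ncone x I} = Pair x -` ?H" for x :: "real ^ 'd ^ 'n"
    by (auto simp: ncone_def)
  then show ?thesis unfolding measure_def by simp
qed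

lemma integral_angle:
  assumes "I \<noteq> {}" "card I \<le> CARD('d)"
  shows "(\<integral>x. measure gauss {z. resid (edges I x) z \<in> ncone x I} \<partial>(gauss :: (real ^ 'd ^ 'n::finite) measure))
       = angle_prob I"
  using nn_integral_angle[OF assms]
  by (subst integral_eq_nn_integral)
    (auto simp: gauss.emeasure_eq_measure angle_prob_def)

text \<open>
  A permutation of the coordinates that maps \<open>I\<close> to \<open>J\<close> preserves the Gaussian measure.
\<close>

lemma angle_prob_cong_card:
  fixes I J :: "'n::finite set"
  assumes "card I = card J"
  shows "angle_prob I = angle_prob J"
proof -
  have "card (- I) = card (- J)" using assms by (simp add: Compl_eq_Diff_UNIV card_Diff_subset)
  then obtain f g where f: "bij_betw f I J" and g: "bij_betw g (- I) (- J)"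
    using assms by (metis finite_same_card_bij finite)
  define h where "h i = (if i \<in> I then f i else g i)" for i
  have "bij_betw h I J" using f bij_betw_cong[of I h f J] by (simp add: h_def)
  moreover have "bij_betw h (- I) (- J)" using g bij_betw_cong[of "- I" h g "- J"] by (simp add: h_def)
  ultimately have "bij_betw h (I \<union> - I) (J \<union> - J)" by (rule bij_betw_combine) simp
  then have h: "bij h" by simp
  have hI: "h i \<in> J \<longleftrightarrow> i \<in> I" for i
    using f g by (auto simp: h_def bij_betw_def)
  have hIJ: "h ` I = J" using f by (auto simp: h_def bij_betw_def)
  define \<pi> :: "real ^ 'n \<Rightarrow> real ^ 'n" where "\<pi> v = (\<chi> i. v $ h i)" for v
  have orth: "orthogonal_transformation \<pi>"
    unfolding orthogonal_transformation_def
  proof (intro conjI allI)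
    show "linear \<pi>" by (rule linearI) (simp_all add: \<pi>_def vec_eq_iff)
    show "\<pi> v \<bullet> \<pi> w = v \<bullet> w" for v w
      unfolding inner_vec_def \<pi>_def using sum.reindex_bij_betw[OF h, of "\<lambda>i. v $ i \<bullet> w $ i"] by simp
  qed
  note [measurable] = borel_measurable_linear[OF orthogonal_transformation_linear[OF orth]]
  have avg: "avg I (\<pi> v) $ i = avg J v $ h i" for v i
  proof -
    have "(\<Sum>l\<in>I. v $ h l) = (\<Sum>l\<in>J. v $ l)"
      unfolding hIJ[symmetric] using h by (subst sum.reindex) (auto simp: bij_def inj_on_def)
    then show ?thesis by (simp add: avg_def \<pi>_def hI assms)
  qed
  have iff: "avg I (\<pi> v) \<in> max_cone I \<longleftrightarrow> avg J v \<in> max_cone J" for v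
  proof -
    have "(\<forall>i\<in>I. \<forall>k. avg J v $ h k \<le> avg J v $ h i) \<longleftrightarrow> (\<forall>i\<in>J. \<forall>k. avg J v $ k \<le> avg J v $ i)"
      unfolding hIJ[symmetric] using h by (auto simp: bij_def surj_def) metis
    then show ?thesis by (simp add: max_cone_def avg)
  qed
  have "angle_prob I = measure (distr gauss borel \<pi>) {v. avg I v \<in> max_cone I}"
    by (simp add: angle_prob_def distr_gauss_orthogonal[OF orth])
  also have "\<dots> = angle_prob J"
    by (subst measure_distr) (auto simp: angle_prob_def iff vimage_def)
  finally show ?thesis .
qed

lemma measurable_angle_sum [measurable]:
  "(\<lambda>x :: real ^ 'd ^ 'n::finite. \<Sum>I\<in>flats j x. measure gauss {z. resid (edges I x) z \<in> ncone x I})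
     \<in> borel_measurable borel"
proof -
  let ?m = "\<lambda>I x. measure gauss {z. resid (edges I x) z \<in> ncone x I}"
  have "(\<Sum>I\<in>flats j x. ?m I x) = (\<Sum>I\<in>UNIV. if I \<in> flats j x then ?m I x else 0)" for x :: "real ^ 'd ^ 'n"
    by (simp add: sum.If_cases)
  then show ?thesis by simp
qed

lemma integral_angle_sum:
  assumes j: "j < CARD('d)" 
  shows "(\<integral>x. (\<Sum>I\<in>flats j x. measure gauss {z. resid (edges I x) z \<in> ncone x I}) \<partial>(gauss :: (real ^ 'd ^ 'n::finite) measure))
       = (\<Sum>I | card I = j + 1. angle_prob (I :: 'n set))"
proof -
  let ?m = "\<lambda>I x. measure gauss {z. resid (edges I x) z \<in> ncone x I}"
  have "(\<integral>x. (\<Sum>I\<in>flats j x. ?m I x) \<partial>(gauss :: (real ^ 'd ^ 'n) measure))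
      = (\<integral>x. (\<Sum>I | card I = j + 1. ?m I x) \<partial>(gauss :: (real ^ 'd ^ 'n) measure))"
  proof (rule integral_cong_AE)
    show "(\<lambda>x :: real ^ 'd ^ 'n. \<Sum>I\<in>flats j x. ?m I x) \<in> borel_measurable gauss" by simp
    show "AE x in (gauss :: (real ^ 'd ^ 'n) measure). (\<Sum>I\<in>flats j x. ?m I x) = (\<Sum>I | card I = j + 1. ?m I x)"
      using AE_general_position by eventually_elim (simp add: general_position_flats j)
  qed simp
  also have "\<dots> = (\<Sum>I | card I = j + 1. \<integral>x. ?m I x \<partial>(gauss :: (real ^ 'd ^ 'n) measure))"
    by (intro Bochner_Integration.integral_sum gauss.integrable_const_bound[where B=1]) auto
  also have "\<dots> = (\<Sum>I | card I = j + 1. angle_prob (I :: 'n set))"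
    using j by (intro sum.cong refl integral_angle) auto
  finally show ?thesis .
qed

text \<open>
  The vertices of the regular simplex are the rows of the identity matrix, for which the normal cone is
  \<open>max_cone I\<close> itself and the indicator of \<open>I\<close> is strictly supporting.
\<close>

lemma solid_angle_simplex_normal_cone:
  fixes I :: "'n::finite set"
  assumes I: "I \<noteq> {}"
  shows "solid_angle (normal_cone (convex hull (\<lambda>i. axis i (1::real)) ` I) (convex hull range (\<lambda>i::'n. axis i 1))) = angle_prob I"
proof -
  let ?e = "mat 1 :: real ^ 'n ^ 'n"
  have row: "?e $ i = axis i 1" for i by (auto simp: mat_def axis_def vec_eq_iff)
  have "level ?e I = {x. \<forall>i\<in>I. \<forall>k\<in>I. x $ i = x $ k}"
    by (simp add: level_def row inner_axis')
  then have p: "orth_proj_on (level ?e I) (avg I)" using orth_proj_on_avg[of I] by simp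
  have "supports ?e I (\<chi> i. if i \<in> I then 1 else 0)"
    by (auto simp: supports_def level_def row inner_axis')
  then have "span (ncone ?e I) = level ?e I" by (rule span_ncone)
  then have "solid_angle (ncone ?e I) = measure gauss {v. avg I v \<in> ncone ?e I}"
    using zero_in_ncone[of ?e I] by (intro solid_angle_eq_gauss[OF p] closed_ncone cone_ncone) auto
  then show ?thesis
    using normal_cone_convex_hull[OF I, of ?e] by (simp add: row angle_prob_def ncone_def)
qed


section \<open>The law of the random configuration\<close>

lemma distr_std_gaussian_vector:
  fixes Y :: "'w \<Rightarrow> real ^ 'd"
  assumes "std_gaussian_vector M Y"
  shows "Y \<in> borel_measurable M" "distr M borel Y = gauss"
proof -
  have d: "distributed M lborel Y (\<lambda>x. ennreal (\<Prod>i\<in>UNIV. std_normal_density (x $ i)))"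
    using assms by (simp add: std_gaussian_vector_def)
  show "Y \<in> borel_measurable M" using distributed_measurable[OF d] by simp
  have Basis: "(Basis :: (real ^ 'd) set) = (\<lambda>i. axis i 1) ` UNIV" by (auto simp: Basis_vec_def)
  have "(\<Prod>b\<in>Basis. std_normal_density (x \<bullet> b)) = (\<Prod>i\<in>UNIV. std_normal_density (x $ i))" for x :: "real ^ 'd"
    unfolding Basis by (subst prod.reindex) (auto simp: inj_on_def axis_eq_axis inner_axis)
  then have "gauss = distr M lborel Y"
    using distributed_distr_eq_density[OF d] by (simp add: gauss_def)
  also have "\<dots> = distr M borel Y" by (rule distr_cong) auto
  finally show "distr M borel Y = gauss" by simp
qed

text \<open>
  On a box, independence turns the law of the matrix into a product over its rows, and the law of each row
  into a product over its entries.
\<close>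

lemma distr_gauss_independent_rows:
  fixes X :: "'i \<Rightarrow> 'w \<Rightarrow> 'a::euclidean_space" and \<sigma> :: "'n::finite \<Rightarrow> 'i"
  assumes M: "prob_space M" and indep: "prob_space.indep_vars M (\<lambda>_. borel) X J"
    and \<sigma>: "inj \<sigma>" "range \<sigma> \<subseteq> J"
    and X: "\<And>i. i \<in> J \<Longrightarrow> X i \<in> borel_measurable M" "\<And>i. i \<in> J \<Longrightarrow> distr M borel (X i) = gauss"
  shows "(\<lambda>\<omega>. \<chi> i. X (\<sigma> i) \<omega>) \<in> borel_measurable M"
    and "distr M borel (\<lambda>\<omega>. \<chi> i. X (\<sigma> i) \<omega>) = gauss"
proof -
  interpret prob_space M by fact
  let ?V = "\<lambda>\<omega>. \<chi> i. X (\<sigma> i) \<omega>"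
  have Xm[measurable]: "X (\<sigma> i) \<in> borel_measurable M" for i using X(1) \<sigma>(2) by auto
  show Vm[measurable]: "?V \<in> borel_measurable M"
  proof (rule iffD2[OF borel_measurable_euclidean_space], intro ballI)
    fix b :: "'a ^ 'n" assume "b \<in> Basis"
    then obtain i c where "b = axis i c" by (auto simp: Basis_vec_def)
    then show "(\<lambda>\<omega>. ?V \<omega> \<bullet> b) \<in> borel_measurable M" by (simp add: inner_axis)
  qed
  show "distr M borel ?V = gauss"
  proof (rule gauss_eqI)
    fix l u :: "'a ^ 'n"
    have Basis: "(Basis :: ('a ^ 'n) set) = (\<lambda>(i, b). axis i b) ` (UNIV \<times> Basis)"
      by (auto simp: Basis_vec_def)
    have inj: "inj_on (\<lambda>(i, b). axis i b :: 'a ^ 'n) (UNIV \<times> Basis)"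
      by (auto simp: inj_on_def axis_eq_axis)
    have box: "v \<in> box l u \<longleftrightarrow> (\<forall>i. v $ i \<in> box (l $ i) (u $ i))" for v
      unfolding mem_box Basis by (auto simp: inner_axis)
    define A where "A i = box (l $ (inv \<sigma> i)) (u $ (inv \<sigma> i))" for i
    have A: "A (\<sigma> i) = box (l $ i) (u $ i)" for i by (simp add: A_def \<sigma>(1))
    have "?V -` box l u \<inter> space M = (\<Inter>i\<in>range \<sigma>. X i -` A i \<inter> space M)"
      by (auto simp: box A)
    then have "emeasure (distr M borel ?V) (box l u) = prob (\<Inter>i\<in>range \<sigma>. X i -` A i \<inter> space M)"
      by (subst emeasure_distr) (auto simp: emeasure_eq_measure)
    also have "prob (\<Inter>i\<in>range \<sigma>. X i -` A i \<inter> space M) = (\<Prod>i\<in>range \<sigma>. prob (X i -` A i \<inter> space M))"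
      by (rule indep_varsD[OF indep]) (use \<sigma>(2) in \<open>auto simp: A_def\<close>)
    also have "\<dots> = (\<Prod>i\<in>UNIV. prob (X (\<sigma> i) -` A (\<sigma> i) \<inter> space M))"
      using \<sigma>(1) by (subst prod.reindex) auto
    also have "ennreal \<dots> = (\<Prod>i\<in>UNIV. emeasure M (X (\<sigma> i) -` A (\<sigma> i) \<inter> space M))"
      by (simp add: prod_ennreal emeasure_eq_measure)
    also have "\<dots> = (\<Prod>i\<in>UNIV. emeasure (distr M borel (X (\<sigma> i))) (box (l $ i) (u $ i)))"
      by (intro prod.cong refl) (subst emeasure_distr, auto simp: A)
    also have "\<dots> = (\<Prod>i\<in>UNIV. \<Prod>b\<in>Basis. emeasure std_normal1 {l $ i \<bullet> b<..<u $ i \<bullet> b})"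
      using \<sigma>(2) by (intro prod.cong refl) (auto simp: X(2) emeasure_gauss_box image_subset_iff)
    also have "\<dots> = (\<Prod>b\<in>Basis. emeasure std_normal1 {l \<bullet> b<..<u \<bullet> b})"
      unfolding Basis prod.reindex[OF inj]
      by (simp add: prod.cartesian_product case_prod_beta inner_axis comp_def)
    finally show "emeasure (distr M borel ?V) (box l u) = (\<Prod>b\<in>Basis. emeasure std_normal1 {l \<bullet> b<..<u \<bullet> b})" .
  qed simp
qed

theorem corollary4p13:
  fixes M :: "'w measure" and X :: "nat \<Rightarrow> 'w \<Rightarrow> real ^ 'd"
    and e :: "nat \<Rightarrow> real ^ 'n" and n j :: nat
  assumes "n \<ge> CARD('d) + 1"
    and "bij_betw e {1..n} (Basis :: (real ^ 'n) set)"
    and "prob_space M"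
    and "\<And>i. i \<in> {1..n} \<Longrightarrow> std_gaussian_vector M (X i)"
    and "prob_space.indep_vars M (\<lambda>_. borel) X {1..n}"
    and "j \<in> {0..CARD('d) - 1}"
  shows "(\<integral>\<omega>. (let P = convex hull ((\<lambda>i. X i \<omega>) ` {1..n})
                in \<Sum>F\<in>faces j P. solid_angle (normal_cone F P)) \<partial>M)
         = ext_angle_sum e n (j + 1)"
proof -
  have j: "j < CARD('d)" using assms(6) zero_less_card_finite[where 'a='d]
    by (simp only: atLeastAtMost_iff) linarith
  define \<epsilon> :: "'n \<Rightarrow> real ^ 'n" where "\<epsilon> i = axis i 1" for i
  have "inj \<epsilon>" by (auto simp: inj_on_def \<epsilon>_def axis_eq_axis)
  moreover have "range \<epsilon> = Basis" by (auto simp: \<epsilon>_def Basis_vec_def)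
  ultimately have \<epsilon>: "bij_betw \<epsilon> UNIV Basis" by (simp add: bij_betw_def)
  define \<sigma> where "\<sigma> = inv_into {1..n} e \<circ> \<epsilon>"
  have \<sigma>: "bij_betw \<sigma> UNIV {1..n}"
    unfolding \<sigma>_def using \<epsilon> bij_betw_inv_into[OF assms(2)] by (rule bij_betw_trans)
  have e\<sigma>: "e (\<sigma> i) = \<epsilon> i" for i
    using bij_betw_inv_into_right[OF assms(2)] bij_betwE[OF \<epsilon>] by (simp add: \<sigma>_def)
  have n: "CARD('n) = n" using bij_betw_same_card[OF \<sigma>] by simp
  define V where "V = (\<lambda>\<omega>. \<chi> i. X (\<sigma> i) \<omega>)"
  have inj: "inj \<sigma>" and range: "range \<sigma> = {1..n}"
    using \<sigma> by (simp_all add: bij_betw_def)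
  note rows = distr_gauss_independent_rows[OF assms(3,5) inj equalityD1[OF range]
      distr_std_gaussian_vector[OF assms(4)]]
  have V: "V \<in> borel_measurable M" "distr M borel V = gauss"
    unfolding V_def by (rule rows; assumption)+
  define G where "G = (\<lambda>x :: real ^ 'd ^ 'n. \<Sum>I\<in>flats j x. measure gauss {z. resid (edges I x) z \<in> ncone x I})"
  have G: "G \<in> borel_measurable borel"
    unfolding G_def by (rule measurable_angle_sum)
  have "(let P = convex hull ((\<lambda>i. X i \<omega>) ` {1..n}) in \<Sum>F\<in>faces j P. solid_angle (normal_cone F P)) = G (V \<omega>)" for \<omega>
  proof -
    have "(\<lambda>i. X i \<omega>) ` {1..n} = pts (V \<omega>) UNIV"
      unfolding range[symmetric] by (simp add: V_def image_image)
    then show ?thesis by (simp add: G_def Let_def angle_sum_eq)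
  qed
  then have "(\<integral>\<omega>. (let P = convex hull ((\<lambda>i. X i \<omega>) ` {1..n})
                in \<Sum>F\<in>faces j P. solid_angle (normal_cone F P)) \<partial>M) = (\<integral>\<omega>. G (V \<omega>) \<partial>M)"
    by simp
  also have "\<dots> = (\<integral>x. G x \<partial>distr M borel V)"
    by (rule integral_distr[OF V(1) G, symmetric])
  also have "\<dots> = (\<Sum>I | card I = j + 1. angle_prob (I :: 'n set))"
    unfolding V(2) G_def by (rule integral_angle_sum[OF j])
  also have "\<dots> = ext_angle_sum e n (j + 1)"
  proof -
    define I0 where "I0 = {i. \<sigma> i \<le> j + 1}"
    have img: "\<sigma> ` I0 = {1..j + 1}"
    proof
      show "\<sigma> ` I0 \<subseteq> {1..j + 1}" using bij_betwE[OF \<sigma>] by (auto simp: I0_def)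
      show "{1..j + 1} \<subseteq> \<sigma> ` I0"
      proof
        fix k assume k: "k \<in> {1..j + 1}"
        then have "k \<in> range \<sigma>" using \<sigma> assms(1) j by (simp add: bij_betw_def)
        then show "k \<in> \<sigma> ` I0" using k by (auto simp: I0_def)
      qed
    qed
    have card: "card I0 = j + 1"
      using card_image[OF inj_on_subset[OF inj subset_UNIV], of I0] img by simp
    then have ne: "I0 \<noteq> {}" by auto
    have "e ` {1..j + 1} = \<epsilon> ` I0" unfolding img[symmetric] image_image e\<sigma> ..
    moreover have "e ` {1..n} = range \<epsilon>" using assms(2) \<epsilon> by (simp add: bij_betw_def)
    ultimately have "ext_angle_sum e n (j + 1) = real (n choose (j + 1)) * angle_prob I0"
      using solid_angle_simplex_normal_cone[OF ne]
      by (simp add: ext_angle_sum_def std_simplex_def \<epsilon>_def[abs_def])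
    moreover have "(\<Sum>I | card I = j + 1. angle_prob (I :: 'n set)) = (\<Sum>I | card (I :: 'n set) = j + 1. angle_prob I0)"
      using card by (intro sum.cong refl angle_prob_cong_card) simp
    moreover have "card {I :: 'n set. card I = j + 1} = n choose (j + 1)"
      using n_subsets[of "UNIV :: 'n set" "j + 1"] by (simp add: n)
    ultimately show ?thesis by simp
  qed
  finally show ?thesis .
qed

end
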